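(* Let $\rho\in(0,1)$ be the loss-of-load probability threshold and $\beta\in(0,1)$, and let (MR2) and (MR3) be the chance-constrained problem and its scenario-based approximation with $K$ independent samples, both defined in the context. Let $N_G$ be the total number of conventional DG units. If $$K \;\ge\; \left\lceil 2\rho^{-1}\ln\beta^{-1} + 4\Big(N_G+\sum_{(m,n)\in\mathcal{E}}|\mathcal{P}_{mn}|\Big) + 4\Big(N_G+\sum_{(m,n)\in\mathcal{E}}|\mathcal{P}_{mn}|\Big)\rho^{-1}\ln\big(2\rho^{-1}\big)\right\rceil ,$$ then the optimal solution $(\boldsymbol{\xi}^{\mathrm{opt}},\{S_{G_n}^{\phi,\mathrm{opt}}\})$ of (MR3) is feasible for (MR2) with probability no less than $1-\beta$, where this probability is with respect to the draw of the $K$ samples.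
   Context: **Network.** $(\mathcal{N},\mathcal{E})$ is a directed graph with nodes $\mathcal{N}=\{1,\dots,N\}$ and lines $\mathcal{E}\subset\mathcal{N}\times\mathcal{N}$; $\mathcal{P}_{mn}\subseteq\{a,b,c\}$ and $\mathcal{P}_n\subseteq\{a,b,c\}$ are the nonempty phase sets of line $(m,n)$ and node $n$; $\mathcal{E}_R\subset\mathcal{E}$ is the set of lines equipped with switches. For each line, $I_{mn}^\phi\in\mathbb{C}$ ($\phi\in\mathcal{P}_{mn}$) are the line currents, and $\boldsymbol{\xi}_{mn}\in\mathbb{R}^{2|\mathcal{P}_{mn}|}$ stacks the real parts and then the imaginary parts of $\{I_{mn}^\phi\}_{\phi\in\mathcal{P}_{mn}}$. The vector $\boldsymbol{\xi}$ stacks all $\boldsymbol{\xi}_{mn}$, $(m,n)\in\mathcal{E}$, and $\boldsymbol{\xi}_R$ stacks those with $(m,n)\in\mathcal{E}_R$. For each node $n$ and phase $\phi\in\mathcal{P}_n$, $\boldsymbol{A}_n^\phi$ is the $2$-row matrix such that $\boldsymbol{A}_n^\phi\boldsymbol{\xi}$ consists of the real and imaginary parts of the injected current given by Kirchhoff's current law, $$I_n^\phi=\sum_{k:(n,k)\in\mathcal{E},\,\phi\in\mathcal{P}_n\cap\mathcal{P}_{nk}}I_{nk}^\phi-\sum_{j:(j,n)\in\mathcal{E},\,\phi\in\mathcal{P}_n\cap\mathcal{P}_{jn}}I_{jn}^\phi .$$ $\bar{\boldsymbol{M}}_{mn}^\phi=\mathbf{I}_2\otimes\mathbf{e}_{mn}^\phi(\mathbf{e}_{mn}^\phi)^{T}$,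 with $\{\mathbf{e}_{mn}^\phi\}_{\phi\in\mathcal{P}_{mn}}$ the canonical basis of $\mathbb{R}^{|\mathcal{P}_{mn}|}$, so that $\boldsymbol{\xi}_{mn}^{T}\bar{\boldsymbol{M}}_{mn}^\phi\boldsymbol{\xi}_{mn}=|I_{mn}^\phi|^2$. $I_{mn}^{\max}$ is a given cap on $|I_{mn}^\phi|$. **Powers.** $S_{G_n}^\phi=P_{G_n}^\phi+jQ_{G_n}^\phi$ is the (controllable) power supplied by conventional distributed generation (DG) at phase $\phi$ of node $n$; each DG unit contributes two real decision variables (active and reactive power), and $S_{G_n}^\phi=0$ where there is no DG unit. For DG units, $S_n^{\min}\preceq(P_{G_n}^\phi,Q_{G_n}^\phi)\preceq S_n^{\max}$ (element-wise) are given box constraints. $S_{L_n}^\phi=P_{L_n}^\phi+jQ_{L_n}^\phi$ is the (random) load and $S_{E_n,r}^\phi=P_{E_n,r}^\phi+jQ_{E_n,r}^\phi$, $r=1,\dots,R_n^\phi$, is the (random) power of the $r$-th renewable source at phase $\phi$ of node $n$. $\mathcal{D}$ is the set of pairs $(\phi,n)$ at which a renewable source and/or a load is present, and $\bar{\mathcal{D}}$ is the set of remaining pairs $(\phi,n)$. The vector $\boldsymbol{\epsilon}_{\iota_n}^\phi\in\mathbb{R}^2$ is a random current-approximation error. With nominal voltage $M_Ne^{j\varphi_N^\phi}$ on phase $\phi$, set $$\boldsymbol{\varphi}_n^\phi=M_N[\Re\{e^{j\varphi_N^\phi}\},\Im\{e^{j\varphi_N^\phi}\}]^{T},\qquad \bar{\boldsymbol{\varphi}}_n^\phi=M_N[\Im\{e^{j\varphi_N^\phi}\},-\Re\{e^{j\varphi_N^\phi}\}]^{T},$$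 $$P_n^\phi=\sum_rP_{E_n,r}^\phi-P_{L_n}^\phi+(\boldsymbol{\varphi}_n^\phi)^{T}\boldsymbol{\epsilon}_{\iota_n}^\phi,\qquad Q_n^\phi=\sum_rQ_{E_n,r}^\phi-Q_{L_n}^\phi+(\bar{\boldsymbol{\varphi}}_n^\phi)^{T}\boldsymbol{\epsilon}_{\iota_n}^\phi .$$ The collection $\{(P_n^\phi,Q_n^\phi)\}_{(\phi,n)\in\mathcal{D}}$ is a random vector with an arbitrary joint distribution. **Cost.** $C(\boldsymbol{\xi},\{S_{G_n}^\phi\})$ is a given convex real-valued cost, and $g(\boldsymbol{\xi}_R)=\lambda\sum_{(m,n)\in\mathcal{E}_R}\|\boldsymbol{\xi}_{mn}\|_2$ with $\lambda>0$. **Problem (MR2).** Minimize $C(\boldsymbol{\xi},\{S_{G_n}^\phi\})+g(\boldsymbol{\xi}_R)$ over $\boldsymbol{\xi}$ and $\{S_{G_n}^\phi\}$ satisfying the DG box constraints, subject to - $\boldsymbol{\xi}_{mn}^{T}\bar{\boldsymbol{M}}_{mn}^\phi\boldsymbol{\xi}_{mn}\le(I_{mn}^{\max})^2$ for all $\phi\in\mathcal{P}_{mn}$, $(m,n)\in\mathcal{E}$; - $\boldsymbol{A}_n^\phi\boldsymbol{\xi}=\mathbf{0}$ for all $(\phi,n)\in\bar{\mathcal{D}}$; - $\Pr\big\{(\boldsymbol{\varphi}_n^\phi)^{T}\boldsymbol{A}_n^\phi\boldsymbol{\xi}-P_{G_n}^\phi\le P_n^\phi\ \text{and}\ (\bar{\boldsymbol{\varphi}}_n^\phi)^{T}\boldsymbol{A}_n^\phi\boldsymbol{\xi}-Q_{G_n}^\phi\le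 Q_n^\phi,\ \forall(\phi,n)\in\mathcal{D}\big\}\ge1-\rho$. **Problem (MR3).** Let $\{(P_n^\phi(k),Q_n^\phi(k))\}_{(\phi,n)\in\mathcal{D}}$, $k=1,\dots,K$, be independent samples of the random vector above. (MR3) has the same objective, DG box constraints, current-magnitude constraints and zero-current constraints as (MR2), with the chance constraint replaced by $$(\boldsymbol{\varphi}_n^\phi)^{T}\boldsymbol{A}_n^\phi\boldsymbol{\xi}\le P_{G_n}^\phi+\min_{k=1,\dots,K}P_n^\phi(k),\qquad(\bar{\boldsymbol{\varphi}}_n^\phi)^{T}\boldsymbol{A}_n^\phi\boldsymbol{\xi}\le Q_{G_n}^\phi+\min_{k=1,\dots,K}Q_n^\phi(k),\qquad\forall(\phi,n)\in\mathcal{D}.$$ *)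

theory Defs
  imports "HOL-Probability.Probability"
begin

datatype phase = Phase_a | Phase_b | Phase_c

instance phase :: finite
proof
  have "(UNIV :: phase set) = {Phase_a, Phase_b, Phase_c}"
    using phase.exhaust by auto
  then show "finite (UNIV :: phase set)"
    by (metis finite.emptyI finite.insertI)
qed

text \<open>
  Nodes are the elements of a finite type \<open>'n\<close>, so that \<open>N = CARD('n)\<close>; a line is an ordered pair
  of nodes and a pair \<open>(\<phi>, n)\<close> is an element of \<open>phase \<times> 'n\<close>.

  A vector \<open>\<xi>\<close> has a coordinate \<open>(l, r, \<phi>)\<close> for every ordered pair of nodes \<open>l\<close> and every
  phase \<open>\<phi>\<close>, with \<open>r = 1\<close> for the real and \<open>r = 2\<close> for the imaginary part of the current.
  The coordinates that do not belong to a phase of a line, and the powers of pairs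
  \<open>(\<phi>, n)\<close> without a generation unit, are padding and are forced to be zero by
  \<open>decision_space\<close> below, whose dimension is twice
  \<open>card (dg net) + (\<Sum>l\<in>lines net. card (line_phases net l))\<close>.
\<close>

type_synonym 'n currents = "real ^ (('n \<times> 'n) \<times> 2 \<times> phase)"
type_synonym 'n powers = "complex ^ (phase \<times> 'n)"
type_synonym 'n decision = "'n currents \<times> 'n powers"

record ('n :: finite) feeder =
  lines :: "('n \<times> 'n) set"
  switched :: "('n \<times> 'n) set"
  line_phases :: "'n \<times> 'n \<Rightarrow> phase set"
  node_phases :: "'n \<Rightarrow> phase set"
  Imax :: "'n \<times> 'n \<Rightarrow> real"
  dg :: "(phase \<times> 'n) set"  \<comment> \<open>one unit for each of these pairs\<close>
  Smin :: "'n \<Rightarrow> real ^ 2"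
  Smax :: "'n \<Rightarrow> real ^ 2"
  loads :: "(phase \<times> 'n) set"
  renewables :: "phase \<times> 'n \<Rightarrow> nat"
  Vnom :: real
  Vang :: "phase \<Rightarrow> real"
  cost :: "'n decision \<Rightarrow> real"
  weight :: real

definition node_pairs :: "'n::finite feeder \<Rightarrow> (phase \<times> 'n) set" where
  "node_pairs net = {(\<phi>, n). \<phi> \<in> node_phases net n}"

definition feeder :: "'n::finite feeder \<Rightarrow> bool" where
  "feeder net \<longleftrightarrow>
     switched net \<subseteq> lines net \<and>
     (\<forall>l\<in>lines net. line_phases net l \<noteq> {}) \<and>
     (\<forall>n. node_phases net n \<noteq> {}) \<and>
     dg net \<subseteq> node_pairs net \<and>
     loads net \<subseteq> node_pairs net"

definition random_pairs :: "'n::finite feeder \<Rightarrow> (phase \<times> 'n) set" where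
  "random_pairs net = {p \<in> node_pairs net. p \<in> loads net \<or> renewables net p > 0}"

definition zero_pairs :: "'n::finite feeder \<Rightarrow> (phase \<times> 'n) set" where
  "zero_pairs net = node_pairs net - random_pairs net"


definition xi_line :: "'n::finite currents \<Rightarrow> 'n \<times> 'n \<Rightarrow> real ^ (2 \<times> phase)" where
  "xi_line \<xi> l = (\<chi> i. \<xi> $ (l, i))"

definition line_current :: "'n::finite currents \<Rightarrow> 'n \<times> 'n \<Rightarrow> phase \<Rightarrow> complex" where
  "line_current \<xi> l \<phi> = Complex (xi_line \<xi> l $ (1, \<phi>)) (xi_line \<xi> l $ (2, \<phi>))"

definition injected_current ::
    "'n::finite feeder \<Rightarrow> phase \<Rightarrow> 'n \<Rightarrow> 'n currents \<Rightarrow> complex" where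
  "injected_current net \<phi> n \<xi> =
     (\<Sum>k | (n, k) \<in> lines net \<and> \<phi> \<in> node_phases net n \<inter> line_phases net (n, k).
        line_current \<xi> (n, k) \<phi>) -
     (\<Sum>j | (j, n) \<in> lines net \<and> \<phi> \<in> node_phases net n \<inter> line_phases net (j, n).
        line_current \<xi> (j, n) \<phi>)"

definition complex_vec :: "complex \<Rightarrow> real ^ 2" where
  "complex_vec z = vector [Re z, Im z]"

definition A_mat ::
    "'n::finite feeder \<Rightarrow> phase \<Rightarrow> 'n \<Rightarrow> real ^ (('n \<times> 'n) \<times> 2 \<times> phase) ^ 2" where
  "A_mat net \<phi> n = matrix (\<lambda>\<xi>. complex_vec (injected_current net \<phi> n \<xi>))"

definition kronecker ::
    "real ^ 'b ^ 'a \<Rightarrow> real ^ 'd ^ 'c \<Rightarrow> real ^ ('b::finite \<times> 'd::finite) ^ ('a::finite \<times> 'c::finite)"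
  where "kronecker A B = (\<chi> i j. A $ fst i $ fst j * B $ snd i $ snd j)"

definition M_bar :: "phase \<Rightarrow> real ^ (2 \<times> phase) ^ (2 \<times> phase)" where
  "M_bar \<phi> = kronecker (mat 1 :: real ^ 2 ^ 2)
     ((columnvector (axis \<phi> 1) :: real ^ 1 ^ phase) ** rowvector (axis \<phi> 1))"

lemma line_current_magnitude:
  "xi_line \<xi> l \<bullet> (M_bar \<phi> *v xi_line \<xi> l) = (cmod (line_current \<xi> l \<phi>))\<^sup>2"
proof -
  have M: "M_bar \<phi> $ i $ j = (if i = j \<and> snd i = \<phi> then 1 else 0)" for i j
    by (auto simp: M_bar_def kronecker_def columnvector_def rowvector_def mat_def axis_def
          matrix_matrix_mult_def prod_eq_iff)
  have "(M_bar \<phi> *v x) $ i = (if snd i = \<phi> then x $ i else 0)" for x i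
    unfolding matrix_vector_mult_def by (simp add: M if_distrib if_distribR cong: if_cong)
  then have "x \<bullet> (M_bar \<phi> *v x) = (\<Sum>i\<in>UNIV. if snd i = \<phi> then (x $ i)\<^sup>2 else 0)" for x
    unfolding inner_vec_def by (auto intro!: sum.cong simp: power2_eq_square)
  also have "\<dots> x = (x $ (1, \<phi>))\<^sup>2 + (x $ (2, \<phi>))\<^sup>2" for x :: "real ^ (2 \<times> phase)"
    unfolding UNIV_Times_UNIV[symmetric]
    by (subst sum.cartesian_product') (simp add: sum_2)
  finally show ?thesis
    by (simp add: line_current_def cmod_power2)
qed

lemma A_mat_mult:
  "A_mat net \<phi> n *v \<xi> = complex_vec (injected_current net \<phi> n \<xi>)"
proof -
  have "linear (\<lambda>\<xi>. complex_vec (injected_current net \<phi> n \<xi>))"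
    by (rule linearI; simp add: vec_eq_iff forall_2 complex_vec_def injected_current_def
          line_current_def xi_line_def sum.distrib sum_distrib_left algebra_simps)
  then show ?thesis
    unfolding A_mat_def by (simp add: matrix_works)
qed


definition decision_space :: "'n::finite feeder \<Rightarrow> 'n decision set" where
  "decision_space net =
     {(\<xi>, S). (\<forall>l r \<phi>. \<not> (l \<in> lines net \<and> \<phi> \<in> line_phases net l) \<longrightarrow> \<xi> $ (l, r, \<phi>) = 0) \<and>
              (\<forall>p. p \<notin> dg net \<longrightarrow> S $ p = 0)}"

lemma subspace_decision_space: "subspace (decision_space net)"
  by (auto simp: subspace_def decision_space_def zero_prod_def)

definition objective :: "'n::finite feeder \<Rightarrow> 'n decision \<Rightarrow> real" where
  "objective net x = cost net x + weight net * (\<Sum>l\<in>switched net. norm (xi_line (fst x) l))"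

definition common_feasible :: "'n::finite feeder \<Rightarrow> 'n decision set" where
  "common_feasible net =
     {(\<xi>, S) \<in> decision_space net.
        (\<forall>(\<phi>, n)\<in>dg net. Smin net n \<le> complex_vec (S $ (\<phi>, n)) \<and>
                           complex_vec (S $ (\<phi>, n)) \<le> Smax net n) \<and>
        (\<forall>l\<in>lines net. \<forall>\<phi>\<in>line_phases net l.
           xi_line \<xi> l \<bullet> (M_bar \<phi> *v xi_line \<xi> l) \<le> (Imax net l)\<^sup>2) \<and>
        (\<forall>(\<phi>, n)\<in>zero_pairs net. A_mat net \<phi> n *v \<xi> = 0)}"

definition varphi :: "'n::finite feeder \<Rightarrow> phase \<Rightarrow> real ^ 2" where
  "varphi net \<phi> = Vnom net *\<^sub>R vector [Re (cis (Vang net \<phi>)), Im (cis (Vang net \<phi>))]"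

definition varphi_bar :: "'n::finite feeder \<Rightarrow> phase \<Rightarrow> real ^ 2" where
  "varphi_bar net \<phi> = Vnom net *\<^sub>R vector [Im (cis (Vang net \<phi>)), - Re (cis (Vang net \<phi>))]"

text \<open>
  The random vector of the pairs \<open>(P, Q)\<close>, as a function of the loads \<open>SL\<close>, the renewable powers
  \<open>SE\<close> and the current-approximation errors \<open>eps\<close>.
\<close>

definition PQ ::
    "'n::finite feeder \<Rightarrow> (phase \<times> 'n \<Rightarrow> 'w \<Rightarrow> complex) \<Rightarrow> (phase \<times> 'n \<Rightarrow> nat \<Rightarrow> 'w \<Rightarrow> complex) \<Rightarrow>
     (phase \<times> 'n \<Rightarrow> 'w \<Rightarrow> real ^ 2) \<Rightarrow> 'w \<Rightarrow> phase \<times> 'n \<Rightarrow> real \<times> real" where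
  "PQ net SL SE eps w =
     (\<lambda>p\<in>random_pairs net.
        ((\<Sum>r=1..renewables net p. Re (SE p r w)) - Re (SL p w) + varphi net (fst p) \<bullet> eps p w,
         (\<Sum>r=1..renewables net p. Im (SE p r w)) - Im (SL p w) + varphi_bar net (fst p) \<bullet> eps p w))"

abbreviation PQ_space :: "'n::finite feeder \<Rightarrow> (phase \<times> 'n \<Rightarrow> real \<times> real) measure" where
  "PQ_space net \<equiv> PiM (random_pairs net) (\<lambda>_. borel)"

definition MR2_feasible ::
    "'n::finite feeder \<Rightarrow> 'w measure \<Rightarrow> ('w \<Rightarrow> phase \<times> 'n \<Rightarrow> real \<times> real) \<Rightarrow> real \<Rightarrow> 'n decision set"
  where
  "MR2_feasible net M Z \<rho> =
     {(\<xi>, S) \<in> common_feasible net.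
        measure M {w \<in> space M. \<forall>(\<phi>, n)\<in>random_pairs net.
          varphi net \<phi> \<bullet> (A_mat net \<phi> n *v \<xi>) - Re (S $ (\<phi>, n)) \<le> fst (Z w (\<phi>, n)) \<and>
          varphi_bar net \<phi> \<bullet> (A_mat net \<phi> n *v \<xi>) - Im (S $ (\<phi>, n)) \<le> snd (Z w (\<phi>, n))}
        \<ge> 1 - \<rho>}"

definition MR3_feasible ::
    "'n::finite feeder \<Rightarrow> nat \<Rightarrow> (nat \<Rightarrow> phase \<times> 'n \<Rightarrow> real \<times> real) \<Rightarrow> 'n decision set" where
  "MR3_feasible net K z =
     {(\<xi>, S) \<in> common_feasible net. \<forall>(\<phi>, n)\<in>random_pairs net.
        varphi net \<phi> \<bullet> (A_mat net \<phi> n *v \<xi>)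
          \<le> Re (S $ (\<phi>, n)) + (MIN k\<in>{1..K}. fst (z k (\<phi>, n))) \<and>
        varphi_bar net \<phi> \<bullet> (A_mat net \<phi> n *v \<xi>)
          \<le> Im (S $ (\<phi>, n)) + (MIN k\<in>{1..K}. snd (z k (\<phi>, n)))}"

definition MR3_optimal ::
    "'n::finite feeder \<Rightarrow> nat \<Rightarrow> (nat \<Rightarrow> phase \<times> 'n \<Rightarrow> real \<times> real) \<Rightarrow> 'n decision set" where
  "MR3_optimal net K z = {x. is_arg_min (objective net) (\<lambda>y. y \<in> MR3_feasible net K z) x}"

text \<open>
  \<open>the_MR3_solution net ts K z x\<close> says that \<open>x\<close> is the only optimal solution left after breaking
  ties by successively minimizing the functions in \<open>ts\<close>.  For \<open>ts = []\<close> it says that \<open>x\<close> is the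
  unique optimal solution.
\<close>

fun break_ties :: "('a \<Rightarrow> real) list \<Rightarrow> 'a set \<Rightarrow> 'a set" where
  "break_ties [] X = X"
| "break_ties (t # ts) X = break_ties ts {x. is_arg_min t (\<lambda>y. y \<in> X) x}"

definition the_MR3_solution ::
    "'n::finite feeder \<Rightarrow> ('n decision \<Rightarrow> real) list \<Rightarrow> nat \<Rightarrow>
     (nat \<Rightarrow> phase \<times> 'n \<Rightarrow> real \<times> real) \<Rightarrow> 'n decision \<Rightarrow> bool" where
  "the_MR3_solution net ts K z x \<longleftrightarrow> break_ties ts (MR3_optimal net K z) = {x}"

lemma the_MR3_solution_Nil:
  "the_MR3_solution net [] K z x \<longleftrightarrow> MR3_optimal net K z = {x}"
  by (simp add: the_MR3_solution_def)

end

theory Submission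
  imports Defs
begin

text \<open>
  Problem (MR3) has \<open>d\<close> real decision variables, two for each generation unit and two for each phase
  of a line. By Helly's theorem its solution \<open>x\<close> is already the solution of the problem that
  keeps only \<open>d\<close> suitable samples: the points better than \<open>x\<close> form a convex set that misses the
  intersection of the constraint sets, and at most \<open>d + 1\<close> of these sets, one of them the set of
  better points, have empty intersection (\<open>break_ties_determined_by_few\<close>). For a fixed choice of the
  \<open>d\<close> samples the remaining \<open>K - d\<close> samples are independent of their solution, so if that solution
  violates the constraints with probability more than \<open>\<rho>\<close>, then all of them satisfy it with probability
  at most \<open>(1 - \<rho>) ^ (K - d)\<close>. Summing over the choices gives the bound
  \<open>(K choose d) * (1 - \<rho>) ^ (K - d)\<close> (\<open>scenario_bound\<close>), and for the stated \<open>K\<close> this is at most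
  \<open>\<beta>\<close> (\<open>sample_size_suffices\<close>).

  The solution is unique for all the samples, but it need not be unique for the \<open>d\<close> samples that
  determine it. The list of tie-breaking functions is therefore extended by the coordinates. This
  leaves at most one solution of every subproblem and does not change a solution that is already
  unique (\<open>break_ties_coordinates_unique\<close>). The points that are better in the resulting lexicographic
  order still form a convex set (\<open>convex_lex_below\<close>).

  The event in question must be shown to be measurable although the solution is defined by
  minimization. The feasible decisions lie in a compact set on which the convex objective and
  tie-breaking functions are continuous. Random compact sets for which hitting a closed set is an
  event keep this property under random constraints and under minimization
  (\<open>compact_multifunction_break_ties\<close>), and for such sets being a single point outside a given closed
  set is an event as well (\<open>compact_multifunction_singleton\<close>).
\<close>

section \<open>Lexicographic minimization\<close>

fun lex_below :: "('a \<Rightarrow> real) list \<Rightarrow> 'a \<Rightarrow> 'a set" where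
  "lex_below [] x = {}"
| "lex_below (t # ts) x = {y. t y < t x \<or> t y = t x \<and> y \<in> lex_below ts x}"

text \<open>
  The recursive definition of \<open>break_ties\<close> is replaced by a condition on the candidate alone. In
  this form optimality for many constraints passes to optimality for few of them as soon as the
  few already exclude every better point.
\<close>

lemma break_ties_iff: "x \<in> break_ties ts X \<longleftrightarrow> x \<in> X \<and> X \<inter> lex_below ts x = {}"
proof (induction ts arbitrary: X)
  case (Cons t ts)
  have "x \<in> break_ties (t # ts) X \<longleftrightarrow>
      is_arg_min t (\<lambda>y. y \<in> X) x \<and> {y. is_arg_min t (\<lambda>y. y \<in> X) y} \<inter> lex_below ts x = {}"
    using Cons.IH by simp
  also have "\<dots> \<longleftrightarrow> x \<in> X \<and> X \<inter> lex_below (t # ts) x = {}"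
    by (fastforce simp: is_arg_min_def)
  finally show ?case .
qed simp

lemma break_ties_subset: "break_ties ts X \<subseteq> X"
  by (rule subsetI) (simp only: break_ties_iff)

lemma break_ties_append: "break_ties (ts @ us) X = break_ties us (break_ties ts X)"
  by (induction ts arbitrary: X) auto

lemma break_ties_singleton: "break_ties ts {x} = {x}"
proof (induction ts)
  case (Cons t ts)
  have "{y. is_arg_min t (\<lambda>y. y \<in> {x}) y} = {x}"
    by (auto simp: is_arg_min_def)
  then show ?case using Cons.IH by simp
qed simp

text \<open>
  A convex combination that reaches the bound \<open>t x\<close> of a convex function \<open>t\<close>, from two points not
  above it, forces both points onto that bound; the comparison then moves on to the next function.
\<close>

lemma convex_lex_below:
  assumes "\<forall>t\<in>set ts. convex_on C t" and "convex C"
  shows "convex (C \<inter> lex_below ts x)"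
  using assms(1)
proof (induction ts)
  case (Cons t ts)
  have t: "convex_on C t" and IH: "convex (C \<inter> lex_below ts x)"
    using Cons by auto
  show ?case
  proof (rule convexI)
    fix y z and u v :: real
    assume y: "y \<in> C \<inter> lex_below (t # ts) x" and z: "z \<in> C \<inter> lex_below (t # ts) x"
      and uv: "0 \<le> u" "0 \<le> v" "u + v = 1"
    let ?w = "u *\<^sub>R y + v *\<^sub>R z"
    have wC: "?w \<in> C"
      using y z uv \<open>convex C\<close> by (auto simp: convex_def)
    have tw: "t ?w \<le> u * t y + v * t z"
      using t y z uv by (auto simp: convex_on_def)
    have le: "t y \<le> t x" "t z \<le> t x"
      using y z by auto
    have bound: "u * t y + v * t z \<le> t x"
      using convex_bound_le[OF le uv] .
    show "?w \<in> C \<inter> lex_below (t # ts) x"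
    proof (cases "t ?w < t x")
      case True
      then show ?thesis using wC by auto
    next
      case False
      then have eq: "t ?w = t x" and sum: "u * t y + v * t z = t x"
        using tw bound by auto
      have "u * (t x - t y) + v * (t x - t z) = (u + v) * t x - (u * t y + v * t z)"
        by (simp add: algebra_simps)
      then have "u * (t x - t y) + v * (t x - t z) = 0"
        using sum uv by simp
      moreover have "0 \<le> u * (t x - t y)" "0 \<le> v * (t x - t z)"
        using uv le by auto
      ultimately have "u * (t x - t y) = 0" "v * (t x - t z) = 0"
        by linarith+
      then have "u = 0 \<or> t y = t x" "v = 0 \<or> t z = t x"
        by auto
      then consider "u = 0" "v = 1" | "u = 1" "v = 0" | "t y = t x" "t z = t x"
        using uv by (metis add.left_neutral add.right_neutral)
      then have "?w \<in> lex_below (t # ts) x"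
      proof cases
        case 3
        then have "y \<in> C \<inter> lex_below ts x" "z \<in> C \<inter> lex_below ts x"
          using y z by auto
        then have "?w \<in> C \<inter> lex_below ts x"
          using IH uv by (auto simp: convex_def)
        then show ?thesis using eq by simp
      qed (use y z in auto)
      then show ?thesis using wC by auto
    qed
  qed
qed simp

lemma lex_below_total:
  "(\<forall>t\<in>set ts. t x = t y) \<or> x \<in> lex_below ts y \<or> y \<in> lex_below ts x"
  by (induction ts) auto

text \<open>The coordinate functionals in some fixed order; any order serves to break ties.\<close>

definition coordinates :: "('a::euclidean_space \<Rightarrow> real) list" where
  "coordinates = (SOME fs. set fs = (\<lambda>b x. x \<bullet> b) ` Basis)"

lemma set_coordinates: "set coordinates = (\<lambda>b x :: 'a::euclidean_space. x \<bullet> b) ` Basis"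
  unfolding coordinates_def by (rule someI_ex) (simp add: finite_list)

text \<open>
  Points that agree in all coordinates are equal, so minimizing the coordinates one after the other
  settles every tie. The coordinates are linear, so this costs nothing in convexity.
\<close>

lemma break_ties_coordinates_unique:
  assumes "x \<in> break_ties (ts @ coordinates) X" "y \<in> break_ties (ts @ coordinates) X"
  shows "x = y"
proof -
  have "\<forall>t\<in>set (ts @ coordinates). t x = t y"
    using lex_below_total[of "ts @ coordinates" x y] assms unfolding break_ties_iff by blast
  then have "\<forall>b\<in>Basis. x \<bullet> b = y \<bullet> b"
    unfolding set_append set_coordinates by (metis (mono_tags, lifting) UnI2 image_eqI)
  then show ?thesis
    by (auto intro!: euclidean_eqI[where x = x and y = y])
qed

section \<open>Helly's theorem and the samples that determine a solution\<close>

text \<open>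
  Helly's theorem in a set of dimension \<open>d\<close>, which may be smaller than the dimension of the ambient
  space. For each set choose a point common to all the other sets. More than \<open>d + 1\<close> such points are
  affinely dependent, and the point that Radon's theorem puts in two hulls lies in every set: for
  each set one of the two parts omits the only chosen point that may lie outside.
\<close>

lemma helly_dim:
  fixes X :: "'i \<Rightarrow> 'a::euclidean_space set"
  assumes "finite A"
    and "\<And>i. i \<in> A \<Longrightarrow> convex (X i)"
    and "\<And>i. i \<in> A \<Longrightarrow> X i \<subseteq> W" and "dim W \<le> d"
    and "\<And>B. B \<subseteq> A \<Longrightarrow> card B \<le> d + 1 \<Longrightarrow> (\<Inter>i\<in>B. X i) \<noteq> {}"
  shows "(\<Inter>i\<in>A. X i) \<noteq> {}"
  using assms(1,2,3,5)
proof (induction A rule: finite_psubset_induct)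
  case (psubset A)
  show ?case
  proof (cases "card A \<le> d + 1")
    case False
    have "\<forall>k\<in>A. \<exists>a. a \<in> (\<Inter>i\<in>A - {k}. X i)"
    proof
      fix k assume "k \<in> A"
      have "(\<Inter>i\<in>A - {k}. X i) \<noteq> {}"
      proof (rule psubset.IH)
        show "A - {k} \<subset> A"
          using \<open>k \<in> A\<close> by blast
        show "(\<Inter>i\<in>B. X i) \<noteq> {}" if "B \<subseteq> A - {k}" "card B \<le> d + 1" for B
          using that by (intro psubset.prems(3)) auto
        show "convex (X i)" "X i \<subseteq> W" if "i \<in> A - {k}" for i
          using that psubset.prems(1,2)[of i] by simp_all
      qed
      then show "\<exists>a. a \<in> (\<Inter>i\<in>A - {k}. X i)" by blast
    qed
    from bchoice[OF this] obtain a where "\<forall>k\<in>A. a k \<in> (\<Inter>i\<in>A - {k}. X i)"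
      by blast
    then have a: "a k \<in> X i" if "k \<in> A" "i \<in> A" "i \<noteq> k" for k i
      using that by blast
    show ?thesis
    proof (cases "inj_on a A")
      case False
      then obtain i j where "i \<in> A" "j \<in> A" "i \<noteq> j" "a i = a j"
        by (auto simp: inj_on_def)
      then have "a i \<in> X l" if "l \<in> A" for l
        using a[of i l] a[of j l] that by (cases "l = i") auto
      then show ?thesis by blast
    next
      case True
      have "a ` A \<subseteq> W"
      proof (intro image_subsetI)
        fix k assume k: "k \<in> A"
        have "A \<noteq> {k}"
          using False by auto
        then obtain i where "i \<in> A" "i \<noteq> k"
          using k by auto
        then show "a k \<in> W"
          using a[of k i] k psubset.prems(2)[of i] by blast
      qed
      then have "dim (a ` A) + 2 \<le> card (a ` A)"
        using dim_subset[of "a ` A" W] \<open>dim W \<le> d\<close> False by (simp add: card_image True)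
      then have "affine_dependent (a ` A)"
        using psubset.hyps by (intro affine_dependent_biggerset_general) auto
      then obtain m p where mp: "m \<inter> p = {}" "m \<union> p = a ` A" "convex hull m \<inter> convex hull p \<noteq> {}"
        using Radon_partition[of "a ` A"] psubset.hyps by auto
      then obtain z where z: "z \<in> convex hull m" "z \<in> convex hull p"
        by auto
      have hull: "convex hull q \<subseteq> X l" if q: "q \<subseteq> a ` A" "a l \<notin> q" "l \<in> A" for q l
      proof (rule hull_minimal)
        show "q \<subseteq> X l"
        proof
          fix b assume "b \<in> q"
          then obtain i where "i \<in> A" "b = a i" "i \<noteq> l"
            using q by blast
          then show "b \<in> X l" using a q by simp
        qed
      qed (use q psubset.prems(1) in simp)
      have "z \<in> X l" if "l \<in> A" for l
      proof (cases "a l \<in> m")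
        case True
        then show ?thesis using mp(1,2) z(2) hull[of p l] that by blast
      next
        case False
        then show ?thesis using mp(2) z(1) hull[of m l] that by blast
      qed
      then show ?thesis by blast
    qed
  qed (rule psubset.prems(3), simp_all)
qed

text \<open>
  The points better than the optimal point \<open>x\<close> form a convex set that misses the intersection of
  the constraint sets. By Helly's theorem it misses the intersection of at most \<open>d + 1\<close> of the
  sets involved; it must be one of these, since all the constraint sets share the point \<open>x\<close>.
\<close>

lemma break_ties_determined_by_few:
  fixes C :: "'a::euclidean_space set"
  assumes "convex C" "dim C \<le> d" "\<And>k. k \<in> A \<Longrightarrow> convex (F k)"
    and "\<forall>t\<in>set ts. convex_on C t"
    and "finite A" "d \<le> card A"
    and x: "x \<in> break_ties ts (C \<inter> (\<Inter>k\<in>A. F k))"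
  shows "\<exists>I\<subseteq>A. card I = d \<and> x \<in> break_ties ts (C \<inter> (\<Inter>k\<in>I. F k))"
proof -
  \<comment> \<open>The index \<open>None\<close> stands for the set of better points.\<close>
  define X where "X = (\<lambda>i. case i of None \<Rightarrow> C \<inter> lex_below ts x | Some k \<Rightarrow> C \<inter> F k)"
  have best: "C \<inter> (\<Inter>k\<in>A. F k) \<inter> lex_below ts x = {}"
    using x unfolding break_ties_iff by (rule conjunct2)
  have "x \<in> C \<inter> (\<Inter>k\<in>A. F k)"
    using x unfolding break_ties_iff by (rule conjunct1)
  then have xC: "x \<in> C" "x \<in> (\<Inter>k\<in>A. F k)"
    by (rule IntD1, rule IntD2)
  have "\<exists>I0\<subseteq>A. card I0 \<le> d \<and> C \<inter> (\<Inter>k\<in>I0. F k) \<inter> lex_below ts x = {}"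
  proof (rule ccontr)
    assume no: "\<not> (\<exists>I0\<subseteq>A. card I0 \<le> d \<and> C \<inter> (\<Inter>k\<in>I0. F k) \<inter> lex_below ts x = {})"
    have "(\<Inter>i\<in>insert None (Some ` A). X i) \<noteq> {}"
    proof (rule helly_dim[where W = C and d = d])
      show "convex (X i)" if "i \<in> insert None (Some ` A)" for i
      proof (cases i)
        case None
        then show ?thesis using convex_lex_below[OF assms(4,1)] by (simp add: X_def)
      next
        case (Some k)
        then show ?thesis using that assms(1) assms(3)[of k] by (auto simp: X_def intro!: convex_Int)
      qed
      show "(\<Inter>i\<in>B. X i) \<noteq> {}" if B: "B \<subseteq> insert None (Some ` A)" "card B \<le> d + 1" for B
      proof (cases "None \<in> B")
        case False
        then have "x \<in> X i" if "i \<in> B" for i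
          using that B xC by (auto simp: X_def)
        then show ?thesis by blast
      next
        case True
        define I where "I = {k. Some k \<in> B}"
        have "finite B"
          using finite_subset[OF B(1)] \<open>finite A\<close> by simp
        then have fin: "finite I"
          unfolding I_def by (intro finite_vimageI[of B Some, unfolded vimage_def]) auto
        have BI: "B = insert None (Some ` I)"
        proof (rule set_eqI)
          show "i \<in> B \<longleftrightarrow> i \<in> insert None (Some ` I)" for i
            using True by (cases i) (simp_all add: I_def image_iff)
        qed
        then have "card B = Suc (card I)"
          using fin by (simp add: card_image)
        moreover have "I \<subseteq> A"
          using B by (auto simp: I_def)
        ultimately have "C \<inter> (\<Inter>k\<in>I. F k) \<inter> lex_below ts x \<noteq> {}"
          using no B(2) by simp
        then obtain y where "y \<in> C \<inter> (\<Inter>k\<in>I. F k) \<inter> lex_below ts x"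
          by blast
        then have "y \<in> (\<Inter>i\<in>B. X i)"
          by (auto simp: BI X_def)
        then show ?thesis by blast
      qed
      show "X i \<subseteq> C" if "i \<in> insert None (Some ` A)" for i
        by (cases i) (auto simp: X_def)
    qed (use assms(2,5) in simp_all)
    then obtain y where "y \<in> (\<Inter>i\<in>insert None (Some ` A). X i)" by blast
    then have "y \<in> X None" "\<forall>k\<in>A. y \<in> X (Some k)"
      by simp_all
    then have "y \<in> C \<inter> (\<Inter>k\<in>A. F k) \<inter> lex_below ts x"
      by (simp add: X_def)
    then show False using best by simp
  qed
  then obtain I0 where I0: "I0 \<subseteq> A" "card I0 \<le> d" "C \<inter> (\<Inter>k\<in>I0. F k) \<inter> lex_below ts x = {}"
    by metis
  then obtain I where I: "I0 \<subseteq> I" "I \<subseteq> A" "card I = d"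
    using exists_subset_between[OF I0(2) \<open>d \<le> card A\<close> I0(1) \<open>finite A\<close>] by blast
  moreover have "(\<Inter>k\<in>I. F k) \<subseteq> (\<Inter>k\<in>I0. F k)" "x \<in> (\<Inter>k\<in>I. F k)"
    using I xC(2) by auto
  ultimately have "x \<in> C \<inter> (\<Inter>k\<in>I. F k)" "C \<inter> (\<Inter>k\<in>I. F k) \<inter> lex_below ts x \<subseteq> {}"
    using I0(3) xC(1) by (simp, metis Int_mono order_refl)
  then have "x \<in> break_ties ts (C \<inter> (\<Inter>k\<in>I. F k))"
    unfolding break_ties_iff by simp
  with I show ?thesis
    by (intro exI[of _ I]) simp
qed

section \<open>Measurability of the set of solutions\<close>

text \<open>
  Testing against closed sets is the right notion here because it survives minimization: which
  closed sets are hit by the minimizers of \<open>t\<close> is decided by which closed sets \<open>{x. t x \<le> r}\<close>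
  with rational \<open>r\<close> are hit before. No measurable selection is needed.
\<close>

definition compact_multifunction :: "'v measure \<Rightarrow> ('v \<Rightarrow> 'a::euclidean_space set) \<Rightarrow> bool" where
  "compact_multifunction M X \<longleftrightarrow>
     (\<forall>v\<in>space M. compact (X v)) \<and>
     (\<forall>Q. closed Q \<longrightarrow> {v \<in> space M. X v \<inter> Q \<noteq> {}} \<in> sets M)"

lemma compact_multifunction_compact:
  "compact_multifunction M X \<Longrightarrow> v \<in> space M \<Longrightarrow> compact (X v)"
  by (simp add: compact_multifunction_def)

lemma compact_multifunction_hits_closed:
  "compact_multifunction M X \<Longrightarrow> closed Q \<Longrightarrow> {v \<in> space M. X v \<inter> Q \<noteq> {}} \<in> sets M"
  by (simp add: compact_multifunction_def)

lemma compact_multifunction_const: "compact C \<Longrightarrow> compact_multifunction M (\<lambda>_. C)"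
  by (simp add: compact_multifunction_def)

text \<open>
  Nested compact sets reduce a random bound \<open>a v\<close> to the rational bounds above it, each of which
  gives a closed set that does not depend on \<open>v\<close>.
\<close>

lemma compact_multifunction_constraint:
  fixes h :: "'a::euclidean_space \<Rightarrow> real"
  assumes X: "compact_multifunction M X" and XC: "\<And>v. v \<in> space M \<Longrightarrow> X v \<subseteq> C"
    and C: "closed C" and h: "continuous_on C h" and a: "a \<in> borel_measurable M"
  shows "compact_multifunction M (\<lambda>v. {x \<in> X v. h x \<le> a v})"
proof -
  have cl: "closed {x \<in> C. h x \<le> r}" for r
    using C h by (intro continuous_on_closed_Collect_le) auto
  have eq: "{x \<in> X v. h x \<le> a v} = X v \<inter> {x \<in> C. h x \<le> a v}" if "v \<in> space M" for v
    using XC[OF that] by auto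
  have "{v \<in> space M. {x \<in> X v. h x \<le> a v} \<inter> Q \<noteq> {}} \<in> sets M" if Q: "closed Q" for Q
  proof -
    have "{x \<in> X v. h x \<le> a v} \<inter> Q \<noteq> {} \<longleftrightarrow>
        (\<forall>r::rat. a v < of_rat r \<longrightarrow> X v \<inter> (Q \<inter> {x \<in> C. h x \<le> of_rat r}) \<noteq> {})"
      if v: "v \<in> space M" for v
    proof
      assume "{x \<in> X v. h x \<le> a v} \<inter> Q \<noteq> {}"
      then show "\<forall>r::rat. a v < of_rat r \<longrightarrow> X v \<inter> (Q \<inter> {x \<in> C. h x \<le> of_rat r}) \<noteq> {}"
        using XC[OF v] by fastforce
    next
      assume R: "\<forall>r::rat. a v < of_rat r \<longrightarrow> X v \<inter> (Q \<inter> {x \<in> C. h x \<le> of_rat r}) \<noteq> {}"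
      obtain r0 :: rat where "a v < of_rat r0"
        using of_rat_dense[of "a v" "a v + 1"] by auto
      then have ne: "X v \<inter> Q \<noteq> {}" using R by blast
      have "compact (X v \<inter> Q)"
        using compact_multifunction_compact[OF X v] Q by (rule compact_Int_closed)
      moreover have "continuous_on (X v \<inter> Q) h"
        using h XC[OF v] by (auto intro: continuous_on_subset)
      ultimately obtain m where m: "m \<in> X v \<inter> Q" "\<forall>y\<in>X v \<inter> Q. h m \<le> h y"
        using continuous_attains_inf ne by blast
      have "h m \<le> a v"
      proof (rule ccontr)
        assume "\<not> h m \<le> a v"
        then obtain r :: rat where "a v < of_rat r" "of_rat r < h m"
          using of_rat_dense[of "a v" "h m"] by auto
        then obtain x where "x \<in> X v \<inter> Q" "h x \<le> of_rat r"
          using R by blast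
        then show False using \<open>of_rat r < h m\<close> m(2) by (metis not_le order_trans)
      qed
      then show "{x \<in> X v. h x \<le> a v} \<inter> Q \<noteq> {}" using m by auto
    qed
    then have "{v \<in> space M. {x \<in> X v. h x \<le> a v} \<inter> Q \<noteq> {}} =
        {v \<in> space M. \<forall>r::rat. a v < of_rat r \<longrightarrow> X v \<inter> (Q \<inter> {x \<in> C. h x \<le> of_rat r}) \<noteq> {}}"
      by blast
    also have "\<dots> \<in> sets M"
    proof (intro sets.sets_Collect_countable_All sets.sets_Collect_imp)
      fix r :: rat
      show "{v \<in> space M. X v \<inter> (Q \<inter> {x \<in> C. h x \<le> of_rat r}) \<noteq> {}} \<in> sets M"
        using X Q cl by (intro compact_multifunction_hits_closed closed_Int)
      show "{v \<in> space M. a v < of_rat r} \<in> sets M"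
        using a by measurable
    qed
    finally show ?thesis .
  qed
  then show ?thesis
    using compact_Int_closed[OF compact_multifunction_compact[OF X] cl]
    by (simp add: compact_multifunction_def eq)
qed

lemma compact_multifunction_constraints:
  fixes h :: "'p \<Rightarrow> 'a::euclidean_space \<Rightarrow> real"
  assumes "finite P" and X: "compact_multifunction M X" and XC: "\<And>v. v \<in> space M \<Longrightarrow> X v \<subseteq> C"
    and C: "closed C"
    and "\<And>p. p \<in> P \<Longrightarrow> continuous_on C (h p)" "\<And>p. p \<in> P \<Longrightarrow> a p \<in> borel_measurable M"
  shows "compact_multifunction M (\<lambda>v. {x \<in> X v. \<forall>p\<in>P. h p x \<le> a p v})"
  using assms(1,5,6)
proof (induction P)
  case (insert q P)
  have "compact_multifunction M (\<lambda>v. {x \<in> {x \<in> X v. \<forall>p\<in>P. h p x \<le> a p v}. h q x \<le> a q v})"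
    using insert XC C by (intro compact_multifunction_constraint[where C = C]) auto
  moreover have "{x \<in> {x \<in> X v. \<forall>p\<in>P. h p x \<le> a p v}. h q x \<le> a q v} =
      {x \<in> X v. \<forall>p\<in>insert q P. h p x \<le> a p v}" for v
    by auto
  ultimately show ?case by simp
qed (use X in simp)

lemma compact_multifunction_arg_min:
  fixes t :: "'a::euclidean_space \<Rightarrow> real"
  assumes X: "compact_multifunction M X" and XC: "\<And>v. v \<in> space M \<Longrightarrow> X v \<subseteq> C"
    and C: "closed C" and t: "continuous_on C t"
  shows "compact_multifunction M (\<lambda>v. {x. is_arg_min t (\<lambda>y. y \<in> X v) x})"
proof -
  have cl: "closed {x \<in> C. t x \<le> r}" for r
    using C t by (intro continuous_on_closed_Collect_le) auto
  have tX: "continuous_on (X v) t" if "v \<in> space M" for v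
    using t XC[OF that] by (rule continuous_on_subset)
  have cpt: "compact {x. is_arg_min t (\<lambda>y. y \<in> X v) x}" if v: "v \<in> space M" for v
  proof (cases "X v = {}")
    case False
    then obtain m where m: "m \<in> X v" "\<forall>y\<in>X v. t m \<le> t y"
      using continuous_attains_inf[of "X v" t] X v tX by (auto simp: compact_multifunction_def)
    then have "{x. is_arg_min t (\<lambda>y. y \<in> X v) x} = X v \<inter> {x \<in> C. t x \<le> t m}"
      using XC[OF v] by (force simp: is_arg_min_def)
    then show ?thesis
      using compact_Int_closed[OF compact_multifunction_compact[OF X v] cl] by simp
  qed (simp add: is_arg_min_def)
  have "{v \<in> space M. {x. is_arg_min t (\<lambda>y. y \<in> X v) x} \<inter> Q \<noteq> {}} \<in> sets M" if Q: "closed Q" for Q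
  proof -
    have char: "{x. is_arg_min t (\<lambda>y. y \<in> X v) x} \<inter> Q \<noteq> {} \<longleftrightarrow>
        X v \<inter> Q \<noteq> {} \<and> (\<forall>r::rat. X v \<inter> {x \<in> C. t x \<le> of_rat r} \<noteq> {} \<longrightarrow>
           X v \<inter> (Q \<inter> {x \<in> C. t x \<le> of_rat r}) \<noteq> {})" (is "?L \<longleftrightarrow> ?R")
      if v: "v \<in> space M" for v
    proof
      assume ?L
      then obtain x where x: "x \<in> X v" "x \<in> Q" "\<forall>y\<in>X v. t x \<le> t y"
        by (force simp: is_arg_min_def)
      then show ?R using XC[OF v] by fastforce
    next
      assume R: ?R
      have "compact (X v \<inter> Q)"
        using compact_multifunction_compact[OF X v] Q by (rule compact_Int_closed)
      moreover have "continuous_on (X v \<inter> Q) t"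
        using tX[OF v] by (auto intro: continuous_on_subset)
      ultimately obtain m where m: "m \<in> X v \<inter> Q" "\<forall>y\<in>X v \<inter> Q. t m \<le> t y"
        using continuous_attains_inf[of "X v \<inter> Q" t] conjunct1[OF R] by blast
      have "\<not> t y < t m" if y: "y \<in> X v" for y
      proof
        assume "t y < t m"
        then obtain r :: rat where r: "t y < of_rat r" "of_rat r < t m"
          using of_rat_dense by blast
        then have "y \<in> X v \<inter> {x \<in> C. t x \<le> of_rat r}"
          using y XC[OF v] by auto
        then obtain x where "x \<in> X v \<inter> Q" "t x \<le> of_rat r"
          using conjunct2[OF R] by blast
        then show False using r(2) m(2) by (metis not_le order_trans)
      qed
      then show ?L using m by (auto simp: is_arg_min_def)
    qed
    then have "{v \<in> space M. {x. is_arg_min t (\<lambda>y. y \<in> X v) x} \<inter> Q \<noteq> {}} =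
        {v \<in> space M. X v \<inter> Q \<noteq> {} \<and> (\<forall>r::rat. X v \<inter> {x \<in> C. t x \<le> of_rat r} \<noteq> {} \<longrightarrow>
           X v \<inter> (Q \<inter> {x \<in> C. t x \<le> of_rat r}) \<noteq> {})}"
      by (simp add: char cong: conj_cong)
    also have "\<dots> \<in> sets M"
      using X Q cl
      by (intro sets.sets_Collect_conj sets.sets_Collect_countable_All sets.sets_Collect_imp
          compact_multifunction_hits_closed closed_Int)
    finally show ?thesis .
  qed
  then show ?thesis
    using cpt by (simp add: compact_multifunction_def)
qed

lemma compact_multifunction_break_ties:
  assumes "compact_multifunction M X" and "\<And>v. v \<in> space M \<Longrightarrow> X v \<subseteq> C"
    and "closed C" and "\<forall>t\<in>set ts. continuous_on C t"
  shows "compact_multifunction M (\<lambda>v. break_ties ts (X v))"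
  using assms
proof (induction ts arbitrary: X)
  case (Cons t ts)
  have "compact_multifunction M (\<lambda>v. {x. is_arg_min t (\<lambda>y. y \<in> X v) x})"
    using Cons.prems by (intro compact_multifunction_arg_min[where C = C]) auto
  moreover have "{x. is_arg_min t (\<lambda>y. y \<in> X v) x} \<subseteq> C" if "v \<in> space M" for v
    using Cons.prems(2)[OF that] by (auto simp: is_arg_min_def)
  ultimately show ?case
    using Cons.IH[of "\<lambda>v. {x. is_arg_min t (\<lambda>y. y \<in> X v) x}"] Cons.prems by simp
qed simp

lemma compact_multifunction_hits_open:
  fixes U :: "'a::euclidean_space set"
  assumes X: "compact_multifunction M X" and U: "open U"
  shows "{v \<in> space M. X v \<inter> U \<noteq> {}} \<in> sets M"
proof -
  obtain Q :: "nat \<Rightarrow> 'a set" where Q: "\<And>n. compact (Q n)" "\<Union>(range Q) = U"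
    by (rule open_Union_compact_subsets[OF U]) (rule that)
  have "X v \<inter> U \<noteq> {} \<longleftrightarrow> (\<exists>n. X v \<inter> Q n \<noteq> {})" for v
    unfolding Q(2)[symmetric] by blast
  then have "{v \<in> space M. X v \<inter> U \<noteq> {}} = (\<Union>n. {v \<in> space M. X v \<inter> Q n \<noteq> {}})"
    by auto
  also have "\<dots> \<in> sets M"
    using compact_multifunction_hits_closed[OF X] compact_imp_closed[OF Q(1)] by blast
  finally show ?thesis .
qed

text \<open>
  A nonempty set fails to be a singleton exactly if it hits two disjoint sets of a countable basis.
\<close>

lemma compact_multifunction_singleton:
  assumes X: "compact_multifunction M X" and G: "closed G"
  shows "{v \<in> space M. \<exists>x. X v = {x} \<and> x \<notin> G} \<in> sets M"
proof -
  obtain B :: "'b set set" where B: "countable B" "topological_basis B"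
    using ex_countable_basis by blast
  define P where "P = {(U, V) \<in> B \<times> B. U \<inter> V = {}}"
  have "countable (B \<times> B)" using B by simp
  then have P: "countable P" by (rule countable_subset[rotated]) (auto simp: P_def)
  have opn: "open U" if "U \<in> B" for U
    using B that by (auto simp: topological_basis_open)
  have "(\<exists>x. X v = {x} \<and> x \<notin> G) \<longleftrightarrow>
      X v \<inter> - G \<noteq> {} \<and> \<not> (\<exists>(U, V)\<in>P. X v \<inter> U \<noteq> {} \<and> X v \<inter> V \<noteq> {})" for v
  proof
    assume "\<exists>x. X v = {x} \<and> x \<notin> G"
    then show "X v \<inter> - G \<noteq> {} \<and> \<not> (\<exists>(U, V)\<in>P. X v \<inter> U \<noteq> {} \<and> X v \<inter> V \<noteq> {})"
      by (auto simp: P_def)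
  next
    assume R: "X v \<inter> - G \<noteq> {} \<and> \<not> (\<exists>(U, V)\<in>P. X v \<inter> U \<noteq> {} \<and> X v \<inter> V \<noteq> {})"
    then obtain x where x: "x \<in> X v" "x \<notin> G" by blast
    have "y = x" if y: "y \<in> X v" for y
    proof (rule ccontr)
      assume "y \<noteq> x"
      then obtain U V where "open U" "open V" "x \<in> U" "y \<in> V" "U \<inter> V = {}"
        using hausdorff[of x y] by auto
      moreover from this obtain U' V' where "U' \<in> B" "x \<in> U'" "U' \<subseteq> U" "V' \<in> B" "y \<in> V'" "V' \<subseteq> V"
        using topological_basisE[OF B(2)] by metis
      ultimately have "(U', V') \<in> P" "X v \<inter> U' \<noteq> {}" "X v \<inter> V' \<noteq> {}"
        using x y by (auto simp: P_def)
      then show False using R by blast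
    qed
    then show "\<exists>x. X v = {x} \<and> x \<notin> G" using x by blast
  qed
  then have "{v \<in> space M. \<exists>x. X v = {x} \<and> x \<notin> G} = {v \<in> space M. X v \<inter> - G \<noteq> {}} -
      (\<Union>(U, V)\<in>P. {v \<in> space M. X v \<inter> U \<noteq> {}} \<inter> {v \<in> space M. X v \<inter> V \<noteq> {}})"
    by auto
  also have "\<dots> \<in> sets M"
    using compact_multifunction_hits_open[OF X] opn G P
    by (intro sets.Diff sets.countable_UN') (auto simp: P_def open_Compl)
  finally show ?thesis .
qed

section \<open>The probability that a scenario solution violates the constraints\<close>

lemma convex_sublevel:
  assumes f: "convex_on C f"
  shows "convex {x \<in> C. f x \<le> b}"
proof (rule convexI)
  fix x y and u v :: real
  assume x: "x \<in> {x \<in> C. f x \<le> b}" and y: "y \<in> {x \<in> C. f x \<le> b}"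
    and uv: "0 \<le> u" "0 \<le> v" "u + v = 1"
  have "f (u *\<^sub>R x + v *\<^sub>R y) \<le> u * f x + v * f y"
    using f x y uv by (auto simp: convex_on_def)
  also have "\<dots> \<le> b"
    using x y uv by (intro convex_bound_le) auto
  finally show "u *\<^sub>R x + v *\<^sub>R y \<in> {x \<in> C. f x \<le> b}"
    using convex_on_imp_convex[OF f] x y uv by (auto simp: convex_def)
qed

text \<open>
  A convex program whose right-hand sides are random. The program with the samples \<open>z k\<close>,
  \<open>k \<in> I\<close>, has the feasible set \<open>feasible I z\<close>, and the list \<open>fs\<close> starts with its objective.
\<close>

locale scenario_program = prob_space D
  for D :: "'s measure" +
  fixes C :: "'a::euclidean_space set"
    and J :: "'j set"
    and h :: "'j \<Rightarrow> 'a \<Rightarrow> real"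
    and c :: "'j \<Rightarrow> 's \<Rightarrow> real"
    and fs :: "('a \<Rightarrow> real) list"
  assumes compact_C: "compact C" and convex_C: "convex C" and finite_J: "finite J"
    and convex_h: "j \<in> J \<Longrightarrow> convex_on C (h j)"
    and continuous_h: "j \<in> J \<Longrightarrow> continuous_on C (h j)"
    and c_measurable: "j \<in> J \<Longrightarrow> c j \<in> borel_measurable D"
    and convex_fs: "t \<in> set fs \<Longrightarrow> convex_on C t"
    and continuous_fs: "t \<in> set fs \<Longrightarrow> continuous_on C t"
begin

definition satisfied :: "'a \<Rightarrow> 's set" where
  "satisfied x = {s \<in> space D. \<forall>j\<in>J. h j x \<le> c j s}"

definition feasible :: "'k set \<Rightarrow> ('k \<Rightarrow> 's) \<Rightarrow> 'a set" where
  "feasible I z = {x \<in> C. \<forall>k\<in>I. \<forall>j\<in>J. h j x \<le> c j (z k)}"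

abbreviation tie_free :: "('a \<Rightarrow> real) list" where
  "tie_free \<equiv> fs @ coordinates"

lemma closed_C: "closed C"
  using compact_C by (rule compact_imp_closed)

lemma satisfied_sets: "satisfied x \<in> sets D"
  unfolding satisfied_def
proof (rule sets.sets_Collect_finite_All[OF _ finite_J])
  fix j assume "j \<in> J"
  note [measurable] = c_measurable[OF this]
  show "{s \<in> space D. h j x \<le> c j s} \<in> sets D"
    by measurable
qed

text \<open>
  Outcomes that satisfy infinitely many members of a convergent sequence of decisions satisfy the
  limit, so the probability of satisfaction is upper semicontinuous.
\<close>

lemma closed_prob_satisfied: "closed {x \<in> C. r \<le> prob (satisfied x)}"
  unfolding closed_sequential_limits
proof (intro allI impI, elim conjE)
  fix x :: "nat \<Rightarrow> 'a" and l
  assume x: "\<forall>n. x n \<in> {x \<in> C. r \<le> prob (satisfied x)}" and lim: "x \<longlonglongrightarrow> l"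
  have l: "l \<in> C"
    using closed_C x lim unfolding closed_sequential_limits by blast
  define T where "T m = (\<Union>n\<in>{m..}. satisfied (x n))" for m
  have T_sets: "T m \<in> sets D" for m
    unfolding T_def using satisfied_sets by (intro sets.countable_UN') auto
  have "satisfied (x m) \<subseteq> T m" for m
    unfolding T_def by blast
  then have "prob (satisfied (x m)) \<le> prob (T m)" for m
    by (intro finite_measure_mono T_sets)
  then have "r \<le> prob (T m)" for m
    using x by (metis (mono_tags, lifting) mem_Collect_eq order_trans)
  moreover have "(\<lambda>m. prob (T m)) \<longlonglongrightarrow> prob (\<Inter>m. T m)"
  proof (rule finite_Lim_measure_decseq)
    show "decseq T"
      unfolding T_def decseq_def by (meson UN_mono atLeast_subset_iff order_refl)
  qed (use T_sets in blast)
  ultimately have "r \<le> prob (\<Inter>m. T m)"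
    by (intro LIMSEQ_le_const) auto
  also have "\<dots> \<le> prob (satisfied l)"
  proof (rule finite_measure_mono[OF _ satisfied_sets])
    show "(\<Inter>m. T m) \<subseteq> satisfied l"
    proof
      fix s assume s: "s \<in> (\<Inter>m. T m)"
      have "h j l \<le> c j s" if j: "j \<in> J" for j
      proof (rule ccontr)
        assume "\<not> h j l \<le> c j s"
        moreover have "(\<lambda>n. h j (x n)) \<longlonglongrightarrow> h j l"
          using continuous_on_tendsto_compose[OF continuous_h[OF j] lim l] x by simp
        ultimately have "\<forall>\<^sub>F n in sequentially. c j s < h j (x n)"
          by (intro order_tendstoD(1)) auto
        then obtain N where N: "\<And>n. n \<ge> N \<Longrightarrow> c j s < h j (x n)"
          by (auto simp: eventually_sequentially)
        obtain n where "n \<ge> N" "s \<in> satisfied (x n)"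
          using s unfolding T_def by auto
        then show False
          using N[of n] j by (force simp: satisfied_def)
      qed
      moreover have "s \<in> space D"
        using s T_sets[of 0] sets.sets_into_space by blast
      ultimately show "s \<in> satisfied l"
        by (simp add: satisfied_def)
    qed
  qed
  finally show "l \<in> {x \<in> C. r \<le> prob (satisfied x)}"
    using l by simp
qed

lemma sample_constraint_measurable:
  "k \<in> A \<Longrightarrow> j \<in> J \<Longrightarrow> (\<lambda>z. c j (z k)) \<in> borel_measurable (PiM A (\<lambda>_. D))"
  using measurable_compose[OF measurable_component_singleton[of k A "\<lambda>_. D"] c_measurable[of j]] .

lemma feasible_multifunction:
  assumes "finite A" "I \<subseteq> A"
  shows "compact_multifunction (PiM A (\<lambda>_. D)) (feasible I)"
proof -
  have "compact_multifunction (PiM A (\<lambda>_. D))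
      (\<lambda>z. {x \<in> C. \<forall>p\<in>I \<times> J. h (snd p) x \<le> c (snd p) (z (fst p))})"
  proof (rule compact_multifunction_constraints[where C = C])
    show "finite (I \<times> J)"
      using assms finite_J finite_subset by blast
    show "compact_multifunction (PiM A (\<lambda>_. D)) (\<lambda>_. C)"
      by (rule compact_multifunction_const[OF compact_C])
    show "(\<lambda>z. c (snd p) (z (fst p))) \<in> borel_measurable (PiM A (\<lambda>_. D))" if "p \<in> I \<times> J" for p
      using that assms by (intro sample_constraint_measurable) auto
  qed (use closed_C continuous_h in auto)
  moreover have "feasible I = (\<lambda>z. {x \<in> C. \<forall>p\<in>I \<times> J. h (snd p) x \<le> c (snd p) (z (fst p))})"
    by (rule ext) (simp add: feasible_def)
  ultimately show ?thesis by simp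
qed

lemma feasible_subset: "feasible I z \<subseteq> C"
  by (auto simp: feasible_def)

lemma continuous_tie_free: "\<forall>t\<in>set tie_free. continuous_on C t"
  using continuous_fs by (auto simp: set_coordinates intro!: continuous_intros)

lemma convex_tie_free: "\<forall>t\<in>set tie_free. convex_on C t"
proof -
  have "convex_on C (\<lambda>x. x \<bullet> b)" for b
    using convex_C by (intro convex_onI) (simp_all add: inner_left_distrib)
  then show ?thesis
    using convex_fs by (auto simp: set_coordinates)
qed

text \<open>
  Once the samples in \<open>I\<close> are fixed, their solution is no longer random. If it is satisfied with
  probability less than \<open>r\<close>, then each of the other samples satisfies it with probability less than
  \<open>r\<close>, independently of the others.
\<close>

lemma scenario_bound_fixed_samples:
  fixes A I :: "'k set" and r :: real
  assumes "finite A" "I \<subseteq> A" "0 \<le> r"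
  defines "E \<equiv> {z \<in> space (PiM A (\<lambda>_. D)). \<exists>x\<in>break_ties tie_free (feasible I z).
      prob (satisfied x) < r \<and> (\<forall>k\<in>A - I. \<forall>j\<in>J. h j x \<le> c j (z k))}"
  shows "E \<in> sets (PiM A (\<lambda>_. D))" and "emeasure (PiM A (\<lambda>_. D)) E \<le> ennreal (r ^ card (A - I))"
proof -
  let ?P = "PiM A (\<lambda>_. D)"
  define X where "X z = {x \<in> break_ties tie_free (feasible I z).
      \<forall>p\<in>(A - I) \<times> J. h (snd p) x \<le> c (snd p) (z (fst p))}" for z
  have sub: "break_ties tie_free (feasible I z) \<subseteq> C" for z
    using break_ties_subset feasible_subset by (rule subset_trans)
  have "compact_multifunction ?P X"
    unfolding X_def
  proof (rule compact_multifunction_constraints[where C = C])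
    show "compact_multifunction ?P (\<lambda>z. break_ties tie_free (feasible I z))"
      by (rule compact_multifunction_break_ties[OF feasible_multifunction[OF assms(1,2)]
            feasible_subset closed_C continuous_tie_free])
    show "(\<lambda>z. c (snd p) (z (fst p))) \<in> borel_measurable ?P" if "p \<in> (A - I) \<times> J" for p
      using that by (intro sample_constraint_measurable) auto
  qed (use closed_C continuous_h finite_J \<open>finite A\<close> sub in auto)
  then have "{z \<in> space ?P. X z \<inter> - {x \<in> C. r \<le> prob (satisfied x)} \<noteq> {}} \<in> sets ?P"
    by (intro compact_multifunction_hits_open open_Compl closed_prob_satisfied)
  moreover have "X z \<inter> - {x \<in> C. r \<le> prob (satisfied x)} = {x \<in> break_ties tie_free (feasible I z).
      prob (satisfied x) < r \<and> (\<forall>k\<in>A - I. \<forall>j\<in>J. h j x \<le> c j (z k))}" for z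
    using subsetD[OF sub[of z]] by (auto simp: X_def not_le)
  then have E_eq: "{z \<in> space ?P. X z \<inter> - {x \<in> C. r \<le> prob (satisfied x)} \<noteq> {}} = E"
    unfolding E_def by simp blast
  ultimately show E: "E \<in> sets ?P" by simp

  interpret product_sigma_finite "\<lambda>_::'k. D"
    by unfold_locales
  have A: "A = I \<union> (A - I)" and fin: "finite I" "finite (A - I)"
    using assms(1,2) finite_subset[OF assms(2,1)] by auto
  interpret PI: prob_space "PiM I (\<lambda>_. D)"
    by (intro prob_space_PiM prob_space_axioms)
  have section_bound: "(\<integral>\<^sup>+ w. indicator E (merge I (A - I) (z, w)) \<partial>PiM (A - I) (\<lambda>_. D))
      \<le> ennreal (r ^ card (A - I))" for z
  proof (cases "\<exists>x\<in>break_ties tie_free (feasible I z). prob (satisfied x) < r")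
    case False
    have "feasible I (merge I (A - I) (z, w)) = feasible I z" for w
      unfolding feasible_def by (auto simp: merge_def)
    then have "indicator E (merge I (A - I) (z, w)) = (0 :: ennreal)" for w
      using False by (auto simp: E_def indicator_def)
    then show ?thesis by simp
  next
    case True
    then obtain x where x: "x \<in> break_ties tie_free (feasible I z)" "prob (satisfied x) < r"
      by blast
    have feas: "feasible I (merge I (A - I) (z, w)) = feasible I z" for w
      unfolding feasible_def by (auto simp: merge_def)
    have "w \<in> (\<Pi>\<^sub>E k\<in>A - I. satisfied x)"
      if w: "w \<in> space (PiM (A - I) (\<lambda>_. D))" "merge I (A - I) (z, w) \<in> E" for w
    proof -
      obtain y where y: "y \<in> break_ties tie_free (feasible I z)"
        "\<forall>k\<in>A - I. \<forall>j\<in>J. h j y \<le> c j (merge I (A - I) (z, w) k)"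
        using w(2) unfolding E_def mem_Collect_eq feas by blast
      have "y = x"
        using break_ties_coordinates_unique y(1) x(1) by blast
      then show ?thesis
        using y(2) w(1) by (auto simp: satisfied_def space_PiM PiE_iff merge_def)
    qed
    then have "(\<integral>\<^sup>+ w. indicator E (merge I (A - I) (z, w)) \<partial>PiM (A - I) (\<lambda>_. D))
        \<le> (\<integral>\<^sup>+ w. indicator (\<Pi>\<^sub>E k\<in>A - I. satisfied x) w \<partial>PiM (A - I) (\<lambda>_. D))"
      by (intro nn_integral_mono) (auto simp: indicator_def)
    also have "\<dots> = emeasure (PiM (A - I) (\<lambda>_. D)) (\<Pi>\<^sub>E k\<in>A - I. satisfied x)"
      using fin satisfied_sets by (intro nn_integral_indicator sets_PiM_I_finite) auto
    also have "\<dots> = ennreal (prob (satisfied x) ^ card (A - I))"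
      using fin satisfied_sets by (simp add: emeasure_PiM emeasure_eq_measure ennreal_power)
    also have "\<dots> \<le> ennreal (r ^ card (A - I))"
      using x(2) by (intro ennreal_leI power_mono) auto
    finally show ?thesis .
  qed
  have "emeasure ?P E = (\<integral>\<^sup>+ z. indicator E z \<partial>PiM (I \<union> (A - I)) (\<lambda>_. D))"
    using E A by simp
  also have "\<dots> = (\<integral>\<^sup>+ z. (\<integral>\<^sup>+ w. indicator E (merge I (A - I) (z, w)) \<partial>PiM (A - I) (\<lambda>_. D))
      \<partial>PiM I (\<lambda>_. D))"
    using E A fin by (intro product_nn_integral_fold) auto
  also have "\<dots> \<le> (\<integral>\<^sup>+ z. ennreal (r ^ card (A - I)) \<partial>PiM I (\<lambda>_. D))"
    by (intro nn_integral_mono section_bound)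
  also have "\<dots> = ennreal (r ^ card (A - I))"
    by (simp add: PI.emeasure_space_1)
  finally show "emeasure ?P E \<le> ennreal (r ^ card (A - I))" .
qed

definition bad_samples :: "'k set \<Rightarrow> real \<Rightarrow> ('k \<Rightarrow> 's) set" where
  "bad_samples A r = {z \<in> space (PiM A (\<lambda>_. D)).
     \<exists>x. break_ties fs (feasible A z) = {x} \<and> prob (satisfied x) < r}"

lemma bad_samples_sets:
  assumes "finite A"
  shows "bad_samples A r \<in> sets (PiM A (\<lambda>_. D))"
proof -
  have "compact_multifunction (PiM A (\<lambda>_. D)) (\<lambda>z. break_ties fs (feasible A z))"
    by (rule compact_multifunction_break_ties[OF feasible_multifunction[OF assms order_refl]
          feasible_subset closed_C]) (use continuous_fs in blast)
  then have "{z \<in> space (PiM A (\<lambda>_. D)). \<exists>x. break_ties fs (feasible A z) = {x} \<and>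
      x \<notin> {x \<in> C. r \<le> prob (satisfied x)}} \<in> sets (PiM A (\<lambda>_. D))"
    by (intro compact_multifunction_singleton closed_prob_satisfied)
  also have "{z \<in> space (PiM A (\<lambda>_. D)). \<exists>x. break_ties fs (feasible A z) = {x} \<and>
      x \<notin> {x \<in> C. r \<le> prob (satisfied x)}} = bad_samples A r"
  proof -
    have "x \<in> C" if "break_ties fs (feasible A z) = {x}" for x z
      using that feasible_subset break_ties_iff[of x fs "feasible A z"] by auto
    then show ?thesis
      unfolding bad_samples_def by (auto simp: not_le)
  qed
  finally show ?thesis .
qed

text \<open>
  After breaking ties by coordinates, the unique solution is also the solution for some \<open>d\<close> of the
  samples, and these can be chosen in \<open>card A choose d\<close> ways. The remaining samples all satisfy it,
  which is unlikely once its probability of satisfaction is below \<open>r\<close>.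
\<close>

theorem scenario_bound:
  fixes A :: "'k set" and r :: real
  assumes "finite A" "dim C \<le> d" "d \<le> card A" "0 \<le> r"
  shows "measure (PiM A (\<lambda>_. D)) (bad_samples A r) \<le> (card A choose d) * r ^ (card A - d)"
proof -
  let ?P = "PiM A (\<lambda>_. D)"
  interpret P: prob_space ?P
    by (intro prob_space_PiM prob_space_axioms)
  define E where "E I = {z \<in> space ?P. \<exists>x\<in>break_ties tie_free (feasible I z).
      prob (satisfied x) < r \<and> (\<forall>k\<in>A - I. \<forall>j\<in>J. h j x \<le> c j (z k))}" for I
  define \<I> where "\<I> = {I. I \<subseteq> A \<and> card I = d}"
  have fin: "finite \<I>"
    unfolding \<I>_def using \<open>finite A\<close> by simp
  have E_sets: "E I \<in> sets ?P" if "I \<in> \<I>" for I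
    using scenario_bound_fixed_samples(1)[of A I r] that assms(1,4) by (simp add: E_def \<I>_def)
  have "bad_samples A r \<subseteq> (\<Union>I\<in>\<I>. E I)"
  proof
    fix z assume "z \<in> bad_samples A r"
    then obtain x where z: "z \<in> space ?P" and x: "break_ties fs (feasible A z) = {x}"
      and r: "prob (satisfied x) < r"
      by (auto simp: bad_samples_def)
    define F where "F k = {x \<in> C. \<forall>j\<in>J. h j x \<le> c j (z k)}" for k
    have feas: "feasible I z = C \<inter> (\<Inter>k\<in>I. F k)" for I
      unfolding feasible_def F_def by auto
    have opt: "x \<in> break_ties tie_free (feasible A z)"
      unfolding break_ties_append x by (simp add: break_ties_singleton)
    have F: "convex (F k)" for k
    proof -
      have "convex {x \<in> C. h j x \<le> c j (z k)}" if "j \<in> J" for j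
        using convex_h[OF that] by (rule convex_sublevel)
      then have "convex (C \<inter> (\<Inter>j\<in>J. {x \<in> C. h j x \<le> c j (z k)}))"
        using convex_C by (intro convex_Int convex_INT) auto
      also have "C \<inter> (\<Inter>j\<in>J. {x \<in> C. h j x \<le> c j (z k)}) = F k"
        unfolding F_def by blast
      finally show ?thesis .
    qed
    have "\<exists>I\<subseteq>A. card I = d \<and> x \<in> break_ties tie_free (feasible I z)"
      unfolding feas
      by (rule break_ties_determined_by_few[OF convex_C assms(2) F convex_tie_free assms(1,3)
            opt[unfolded feas]])
    then obtain I where I: "I \<subseteq> A" "card I = d" "x \<in> break_ties tie_free (feasible I z)"
      by metis
    have "x \<in> feasible A z"
      using subsetD[OF break_ties_subset opt] .
    then have "\<forall>k\<in>A - I. \<forall>j\<in>J. h j x \<le> c j (z k)"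
      by (simp add: feasible_def)
    then have "z \<in> E I"
      unfolding E_def using z r I(3) by blast
    then show "z \<in> (\<Union>I\<in>\<I>. E I)"
      using I by (auto simp: \<I>_def)
  qed
  then have "P.prob (bad_samples A r) \<le> P.prob (\<Union>I\<in>\<I>. E I)"
    using fin E_sets by (intro P.finite_measure_mono sets.finite_UN) auto
  also have "\<dots> \<le> (\<Sum>I\<in>\<I>. P.prob (E I))"
    using fin E_sets by (intro P.finite_measure_subadditive_finite) auto
  also have "\<dots> \<le> (\<Sum>I\<in>\<I>. r ^ (card A - d))"
  proof (rule sum_mono)
    fix I assume I: "I \<in> \<I>"
    then have "finite I" "card (A - I) = card A - d"
      using finite_subset[of I A] \<open>finite A\<close> by (auto simp: \<I>_def card_Diff_subset)
    then have "emeasure ?P (E I) \<le> ennreal (r ^ (card A - d))"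
      using scenario_bound_fixed_samples(2)[of A I r] I assms unfolding E_def by (simp add: \<I>_def)
    then show "P.prob (E I) \<le> r ^ (card A - d)"
      using \<open>0 \<le> r\<close> by (simp add: P.emeasure_eq_measure)
  qed
  also have "\<dots> = (card A choose d) * r ^ (card A - d)"
    unfolding \<I>_def using n_subsets[OF \<open>finite A\<close>] by simp
  finally show ?thesis .
qed

end

section \<open>The number of samples\<close>

text \<open>
  The binomial coefficient is at most \<open>K ^ d / fact d\<close>, and \<open>(\<rho> * K / 2) ^ d / fact d\<close> is a term
  of the series of \<open>exp (\<rho> * K / 2)\<close>. Half of the decay \<open>exp (- \<rho> * K)\<close> thus pays for the choice
  of the determining samples, which is where the factor 2 in the sample size comes from.
\<close>

lemma sample_size_suffices:
  fixes \<rho> \<beta> :: real and K d :: nat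
  assumes \<rho>: "0 < \<rho>" "\<rho> < 1" and \<beta>: "0 < \<beta>" "\<beta> < 1"
    and K: "2 / \<rho> * ln (1 / \<beta>) + 2 * d + 2 * d / \<rho> * ln (2 / \<rho>) \<le> K"
  shows "d \<le> K" and "(K choose d) * (1 - \<rho>) ^ (K - d) \<le> \<beta>"
proof -
  have "0 \<le> 2 / \<rho> * ln (1 / \<beta>)" "0 \<le> 2 * d / \<rho> * ln (2 / \<rho>)"
    using \<rho> \<beta> by (auto intro!: mult_nonneg_nonneg)
  then show dK: "d \<le> K"
    using K by simp
  have "(K choose d) * fact d \<le> (real K) ^ d"
    using binomial_fact_pow[of K d] by (metis of_nat_fact of_nat_le_iff of_nat_mult of_nat_power)
  then have "(K choose d) \<le> (real K) ^ d / fact d"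
    by (simp add: pos_le_divide_eq)
  also have "\<dots> = (2 / \<rho>) ^ d * ((\<rho> * K / 2) ^ d / fact d)"
    using \<rho> by (simp add: power_mult_distrib[symmetric])
  also have "\<dots> \<le> (2 / \<rho>) ^ d * exp (\<rho> * K / 2)"
  proof (intro mult_left_mono)
    have "(\<Sum>n\<in>{d}. (\<rho> * K / 2) ^ n /\<^sub>R fact n) \<le> exp (\<rho> * K / 2)"
      unfolding exp_def using \<rho> by (intro sum_le_suminf summable_exp_generic) auto
    then show "(\<rho> * K / 2) ^ d / fact d \<le> exp (\<rho> * K / 2)"
      by (simp add: field_simps)
  qed (use \<rho> in simp)
  finally have choose: "(K choose d) \<le> (2 / \<rho>) ^ d * exp (\<rho> * K / 2)" .
  have "(1 - \<rho>) ^ (K - d) \<le> exp (- \<rho>) ^ (K - d)"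
    using \<rho> exp_ge_add_one_self[of "- \<rho>"] by (intro power_mono) auto
  also have "\<dots> = exp (- \<rho> * (real K - d))"
    using dK by (simp add: exp_of_nat_mult[symmetric] of_nat_diff mult.commute)
  finally have decay: "(1 - \<rho>) ^ (K - d) \<le> exp (- \<rho> * (real K - d))" .
  have "(K choose d) * (1 - \<rho>) ^ (K - d) \<le>
      ((2 / \<rho>) ^ d * exp (\<rho> * K / 2)) * exp (- \<rho> * (real K - d))"
    using choose decay \<rho> by (intro mult_mono) auto
  also have "(2 / \<rho>) ^ d = exp (d * ln (2 / \<rho>))"
    using \<rho> by (simp add: exp_of_nat_mult)
  also have "exp (d * ln (2 / \<rho>)) * exp (\<rho> * K / 2) * exp (- \<rho> * (real K - d)) =
      exp (d * ln (2 / \<rho>) + \<rho> * d - \<rho> * K / 2)"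
    by (simp add: exp_add[symmetric] algebra_simps)
  also have "\<dots> \<le> exp (- ln (1 / \<beta>))"
  proof -
    have "\<rho> / 2 * (2 / \<rho> * ln (1 / \<beta>) + 2 * d + 2 * d / \<rho> * ln (2 / \<rho>)) \<le> \<rho> / 2 * K"
      using K \<rho> by (intro mult_left_mono) auto
    moreover have "\<rho> / 2 * (2 / \<rho> * ln (1 / \<beta>) + 2 * d + 2 * d / \<rho> * ln (2 / \<rho>)) =
        ln (1 / \<beta>) + \<rho> * d + d * ln (2 / \<rho>)"
      using \<rho> by (simp add: field_simps)
    ultimately show ?thesis by simp
  qed
  also have "\<dots> = \<beta>"
    using \<beta> by (simp add: ln_div)
  finally show "(K choose d) * (1 - \<rho>) ^ (K - d) \<le> \<beta>" .
qed

section \<open>The feeder\<close>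

text \<open>
  Convexity gives continuity on open sets, and a proper subspace is not open. A linear projection
  onto the subspace extends the function to a convex function on the whole space.
\<close>

lemma convex_on_subspace_continuous:
  fixes W :: "'a::euclidean_space set"
  assumes W: "subspace W" and f: "convex_on W f"
  shows "continuous_on W f"
proof -
  obtain p where p: "range p \<subseteq> W" "linear p" "\<forall>w\<in>W. p w = w"
    using linear_exists_left_inverse_on[OF linear_id W] by auto
  interpret p: linear p by fact
  have "convex_on UNIV (f \<circ> p)"
  proof (rule convex_onI)
    fix t :: real and x y assume "0 < t" "t < 1"
    moreover have "p x \<in> W" "p y \<in> W"
      using p(1) by auto
    ultimately show "(f \<circ> p) ((1 - t) *\<^sub>R x + t *\<^sub>R y) \<le> (1 - t) * (f \<circ> p) x + t * (f \<circ> p) y"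
      using convex_onD[OF f, of t "p x" "p y"] by (simp add: p.add p.scaleR)
  qed simp
  then have "continuous_on W (f \<circ> p)"
    using convex_on_continuous[OF open_UNIV] continuous_on_subset by blast
  then show ?thesis
    using p(3) by (simp cong: continuous_on_cong)
qed

text \<open>Each phase of a line and each generation unit contributes two real coordinates.\<close>

lemma dim_decision_space_le:
  fixes net :: "'n::finite feeder"
  shows
  "dim (decision_space net) \<le>
     2 * (card (dg net) + (\<Sum>l\<in>lines net. card (line_phases net l)))"
proof -
  define I where "I = (SIGMA l:lines net. (UNIV :: 2 set) \<times> line_phases net l)"
  define B1 where "B1 = (\<lambda>i. (axis i 1, 0) :: 'n decision) ` I"
  define B2 where "B2 = (\<lambda>(p, z). (0, axis p z) :: 'n decision) ` (dg net \<times> {1, \<i>})"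
  have "card B1 \<le> card I"
    unfolding B1_def by (intro card_image_le) simp
  also have "card I = 2 * (\<Sum>l\<in>lines net. card (line_phases net l))"
    unfolding I_def by (simp add: card_SigmaI card_cartesian_product sum_distrib_left)
  finally have B1: "card B1 \<le> 2 * (\<Sum>l\<in>lines net. card (line_phases net l))" .
  have "card B2 \<le> card (dg net \<times> {1, \<i>})"
    unfolding B2_def by (intro card_image_le) simp
  also have "\<dots> = 2 * card (dg net)"
    by (simp add: card_cartesian_product complex_eq_iff)
  finally have B2: "card B2 \<le> 2 * card (dg net)" .
  have "decision_space net \<subseteq> span (B1 \<union> B2)"
  proof
    fix x assume x: "x \<in> decision_space net"
    obtain \<xi> S where xS: "x = (\<xi>, S)" by (cases x)
    have \<xi>0: "\<xi> $ i = 0" if "i \<notin> I" for i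
      using x that unfolding xS decision_space_def I_def by (cases i) auto
    have S0: "S $ p = 0" if "p \<notin> dg net" for p
      using x that unfolding xS decision_space_def by (cases p) auto
    have eq: "x = (\<Sum>i\<in>I. \<xi> $ i *\<^sub>R (axis i 1, 0)) +
        (\<Sum>p\<in>dg net. Re (S $ p) *\<^sub>R (0, axis p 1) + Im (S $ p) *\<^sub>R (0, axis p \<i>))" (is "_ = ?y")
    proof (rule prod_eqI)
      have "fst ?y $ j = \<xi> $ j" for j
        using \<xi>0[of j]
        by (simp add: fst_sum axis_def if_distrib if_distribR cong: if_cong)
      then show "fst x = fst ?y"
        by (simp add: xS vec_eq_iff)
      have "snd ?y $ q = (\<Sum>p\<in>dg net. if p = q then S $ p else 0)" for q
      proof -
        have "snd ?y $ q = (\<Sum>p\<in>dg net. Re (S $ p) *\<^sub>R (axis p 1 $ q) + Im (S $ p) *\<^sub>R (axis p \<i> $ q))"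
          by (simp add: snd_sum)
        also have "\<dots> = (\<Sum>p\<in>dg net. if p = q then S $ p else 0)"
          by (intro sum.cong refl) (auto simp: axis_def complex_eq_iff)
        finally show ?thesis .
      qed
      then have "snd ?y $ q = S $ q" for q
        using S0[of q] by simp
      then show "snd x = snd ?y"
        by (simp add: xS vec_eq_iff)
    qed
    have "(axis i 1, 0) \<in> span (B1 \<union> B2)" if "i \<in> I" for i
      using that by (intro span_base) (auto simp: B1_def)
    moreover have "(0, axis p z) \<in> span (B1 \<union> B2)" if "p \<in> dg net" "z \<in> {1, \<i>}" for p z
      using that by (intro span_base) (force simp: B2_def)
    ultimately show "x \<in> span (B1 \<union> B2)"
      unfolding eq by (intro span_add span_sum span_scale) auto
  qed
  moreover have "finite (B1 \<union> B2)"
    unfolding B1_def B2_def by simp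
  ultimately have "dim (decision_space net) \<le> card (B1 \<union> B2)"
    by (rule dim_le_card)
  also have "\<dots> \<le> card B1 + card B2"
    by (rule card_Un_le)
  finally show ?thesis using B1 B2 by simp
qed

lemma linear_line_current: "linear (\<lambda>x :: 'n::finite decision. line_current (fst x) l \<phi>)"
  by (rule linearI) (simp_all add: line_current_def xi_line_def complex_eq_iff)

lemma linear_generation: "linear (\<lambda>x :: 'n::finite decision. complex_vec (snd x $ p))"
  by (rule linearI) (simp_all add: complex_vec_def vec_eq_iff forall_2)

lemma linear_injection: "linear (\<lambda>x :: 'n::finite decision. A_mat net \<phi> n *v fst x)"
  by (rule linearI) (simp_all add: matrix_vector_right_distrib matrix_vector_mult_scaleR)

text \<open>
  Convexity and closedness can be read off once the constraints are preimages of boxes, discs and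
  points under linear maps.
\<close>

lemma common_feasible_eq:
  "common_feasible net = decision_space net
     \<inter> (\<Inter>(\<phi>, n)\<in>dg net. (\<lambda>x. complex_vec (snd x $ (\<phi>, n))) -` cbox (Smin net n) (Smax net n))
     \<inter> (\<Inter>l\<in>lines net. \<Inter>\<phi>\<in>line_phases net l.
          (\<lambda>x. line_current (fst x) l \<phi>) -` cball 0 \<bar>Imax net l\<bar>)
     \<inter> (\<Inter>(\<phi>, n)\<in>zero_pairs net. (\<lambda>x. A_mat net \<phi> n *v fst x) -` {0})"
  unfolding common_feasible_def line_current_magnitude interval_cbox_cart[symmetric]
  by (auto simp: abs_le_square_iff[symmetric])

lemma convex_common_feasible: "convex (common_feasible net)"
  unfolding common_feasible_eq
  by (intro convex_Int convex_INT subspace_imp_convex[OF subspace_decision_space])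
    (auto intro!: convex_INT convex_linear_vimage linear_generation linear_line_current
      linear_injection)

lemma closed_linear_vimage:
  fixes f :: "'a::euclidean_space \<Rightarrow> 'b::euclidean_space"
  shows "linear f \<Longrightarrow> closed S \<Longrightarrow> closed (f -` S)"
  by (intro closed_vimage linear_continuous_on) (simp_all add: linear_linear)

lemma closed_common_feasible:
  fixes net :: "'n::finite feeder"
  shows "closed (common_feasible net)"
  unfolding common_feasible_eq
  by (intro closed_Int closed_subspace[OF subspace_decision_space])
    (auto intro!: closed_INT closed_linear_vimage linear_generation linear_line_current
      linear_injection)

lemma bounded_common_feasible:
  fixes net :: "'n::finite feeder"
  shows "bounded (common_feasible net)"
proof -
  define r1 where "r1 = (\<Sum>i\<in>(UNIV :: (('n \<times> 'n) \<times> 2 \<times> phase) set). \<bar>Imax net (fst i)\<bar>)"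
  define b where "b n = \<bar>Smin net n $ 1\<bar> + \<bar>Smax net n $ 1\<bar> + (\<bar>Smin net n $ 2\<bar> + \<bar>Smax net n $ 2\<bar>)"
    for n
  define r2 where "r2 = (\<Sum>p\<in>(UNIV :: (phase \<times> 'n) set). b (snd p))"
  have "common_feasible net \<subseteq> cball 0 r1 \<times> cball 0 r2"
  proof
    fix x assume x: "x \<in> common_feasible net"
    have dec: "x \<in> decision_space net"
      using x by (auto simp: common_feasible_def)
    have \<xi>: "\<bar>fst x $ i\<bar> \<le> \<bar>Imax net (fst i)\<bar>" for i
    proof -
      obtain l r \<phi> where i: "i = (l, r, \<phi>)" by (cases i)
      show ?thesis
      proof (cases "l \<in> lines net \<and> \<phi> \<in> line_phases net l")
        case True
        then have "cmod (line_current (fst x) l \<phi>) \<le> \<bar>Imax net l\<bar>"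
          using x unfolding common_feasible_eq by auto
        moreover have "\<bar>fst x $ i\<bar> \<le> cmod (line_current (fst x) l \<phi>)"
          using exhaust_2[of r] abs_Re_le_cmod[of "line_current (fst x) l \<phi>"]
            abs_Im_le_cmod[of "line_current (fst x) l \<phi>"]
          by (auto simp: i line_current_def xi_line_def)
        ultimately show ?thesis by (simp add: i)
      next
        case False
        then show ?thesis using dec by (cases l) (auto simp: i decision_space_def)
      qed
    qed
    have S: "cmod (snd x $ p) \<le> b (snd p)" for p
    proof (cases "p \<in> dg net")
      case True
      obtain \<phi> n where p: "p = (\<phi>, n)" by (cases p)
      have "complex_vec (snd x $ p) \<in> cbox (Smin net n) (Smax net n)"
        using x True unfolding common_feasible_eq p by auto
      then have "\<bar>Re (snd x $ p)\<bar> + \<bar>Im (snd x $ p)\<bar> \<le> b n"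
        unfolding interval_cbox_cart[symmetric] b_def
        by (auto simp: complex_vec_def less_eq_vec_def forall_2)
      then show ?thesis
        using cmod_le[of "snd x $ p"] by (simp add: p)
    next
      case False
      then show ?thesis using dec by (cases p) (auto simp: decision_space_def b_def)
    qed
    have "norm (fst x) \<le> r1"
      unfolding r1_def using norm_le_l1_cart[of "fst x"] sum_mono[OF \<xi>] by (rule order_trans)
    moreover have "norm (snd x) \<le> r2"
      unfolding r2_def norm_vec_def
      using L2_set_le_sum[of UNIV "\<lambda>p. cmod (snd x $ p)"]
        sum_mono[of UNIV "\<lambda>p. cmod (snd x $ p)" "\<lambda>p. b (snd p)"] S
      by simp
    ultimately show "x \<in> cball 0 r1 \<times> cball 0 r2"
      by (cases x) simp
  qed
  then show ?thesis
    by (rule bounded_subset[OF bounded_Times[OF bounded_cball bounded_cball]])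
qed

lemma compact_common_feasible:
  fixes net :: "'n::finite feeder"
  shows "compact (common_feasible net)"
  using bounded_common_feasible closed_common_feasible by (auto simp: compact_eq_bounded_closed)

lemma common_feasible_subset: "common_feasible net \<subseteq> decision_space net"
  by (auto simp: common_feasible_def)

lemma convex_on_objective:
  fixes net :: "'n::finite feeder"
  assumes "convex_on (decision_space net) (cost net)" "weight net > 0"
  shows "convex_on (decision_space net) (objective net)"
proof -
  have W: "convex (decision_space net)"
    by (rule subspace_imp_convex[OF subspace_decision_space])
  have "convex_on (decision_space net) (\<lambda>x. norm (xi_line (fst x) l))" for l
  proof (rule convex_onI[OF _ W])
    fix t :: real and x y :: "'n decision" assume t: "0 < t" "t < 1"
    have "xi_line (fst ((1 - t) *\<^sub>R x + t *\<^sub>R y)) l =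
        (1 - t) *\<^sub>R xi_line (fst x) l + t *\<^sub>R xi_line (fst y) l"
      by (simp add: xi_line_def vec_eq_iff)
    then show "norm (xi_line (fst ((1 - t) *\<^sub>R x + t *\<^sub>R y)) l) \<le>
        (1 - t) * norm (xi_line (fst x) l) + t * norm (xi_line (fst y) l)"
      using norm_triangle_ineq[of "(1 - t) *\<^sub>R xi_line (fst x) l" "t *\<^sub>R xi_line (fst y) l"] t by simp
  qed
  moreover have "convex_on (decision_space net) (\<lambda>x. \<Sum>l\<in>L. f l x)"
    if "finite L" "\<And>l. convex_on (decision_space net) (f l)"
    for L :: "('n \<times> 'n) set" and f :: "'n \<times> 'n \<Rightarrow> 'n decision \<Rightarrow> real"
    using that(1)
  proof induction
    case empty
    then show ?case using W by (simp add: convex_on_def)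
  next
    case (insert l L)
    then show ?case using that(2)[of l] by (simp add: convex_on_add)
  qed
  ultimately have "convex_on (decision_space net)
      (\<lambda>x. cost net x + weight net * (\<Sum>l\<in>switched net. norm (xi_line (fst x) l)))"
    using assms by (intro convex_on_add convex_on_cmul) auto
  then show ?thesis
    by (simp add: objective_def[abs_def])
qed

text \<open>
  The constraints of both problems in the form \<open>h j x \<le> c j s\<close>: for each pair \<open>(\<phi>, n)\<close> one for the
  active and one for the reactive power.
\<close>

fun power_deficit :: "'n::finite feeder \<Rightarrow> bool \<times> phase \<times> 'n \<Rightarrow> 'n decision \<Rightarrow> real" where
  "power_deficit net (active, \<phi>, n) x =
     (if active then varphi net \<phi> \<bullet> (A_mat net \<phi> n *v fst x) - Re (snd x $ (\<phi>, n))
      else varphi_bar net \<phi> \<bullet> (A_mat net \<phi> n *v fst x) - Im (snd x $ (\<phi>, n)))"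

fun random_power :: "bool \<times> phase \<times> 'n \<Rightarrow> (phase \<times> 'n \<Rightarrow> real \<times> real) \<Rightarrow> real" where
  "random_power (active, p) z = (if active then fst (z p) else snd (z p))"

lemma linear_power_deficit: "linear (power_deficit net j)"
proof (cases j)
  case (fields active \<phi> n)
  have lin: "linear (\<lambda>x :: 'a decision. A_mat net \<phi> n *v fst x)"
    by (rule linear_injection)
  show ?thesis
    unfolding fields
    by (rule linearI; cases active)
      (simp_all add: linear_add[OF lin] linear_scale[OF lin] inner_right_distrib algebra_simps)
qed

lemma random_power_measurable:
  fixes net :: "'n::finite feeder"
  assumes "j \<in> UNIV \<times> random_pairs net"
  shows "random_power j \<in> borel_measurable (PQ_space net)"
proof -
  obtain active p where j: "j = (active, p)"
    by (cases j)
  have p: "(\<lambda>z. z p) \<in> measurable (PQ_space net) (borel :: (real \<times> real) measure)"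
    using assms j by (intro measurable_component_singleton) auto
  have "(\<lambda>z. fst (z p)) \<in> borel_measurable (PQ_space net)"
    "(\<lambda>z. snd (z p)) \<in> borel_measurable (PQ_space net)"
    using measurable_compose[OF p borel_measurable_continuous_onI[of fst]]
      measurable_compose[OF p borel_measurable_continuous_onI[of snd]]
    by (simp_all add: continuous_on_fst continuous_on_snd continuous_on_id)
  then show ?thesis
    unfolding j by (cases active) (simp_all add: random_power.simps[abs_def])
qed

lemma power_constraints_iff:
  "(\<forall>j\<in>UNIV \<times> random_pairs net. power_deficit net j x \<le> random_power j z) \<longleftrightarrow>
     (\<forall>(\<phi>, n)\<in>random_pairs net.
        varphi net \<phi> \<bullet> (A_mat net \<phi> n *v fst x) - Re (snd x $ (\<phi>, n)) \<le> fst (z (\<phi>, n)) \<and>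
        varphi_bar net \<phi> \<bullet> (A_mat net \<phi> n *v fst x) - Im (snd x $ (\<phi>, n)) \<le> snd (z (\<phi>, n)))"
  by (force simp: all_bool_eq)

lemma PQ_measurable:
  fixes net :: "'n::finite feeder"
  assumes "\<And>p. p \<in> random_pairs net \<Longrightarrow> SL p \<in> borel_measurable M"
    and "\<And>p r. p \<in> random_pairs net \<Longrightarrow> r \<in> {1..renewables net p} \<Longrightarrow> SE p r \<in> borel_measurable M"
    and "\<And>p. p \<in> random_pairs net \<Longrightarrow> eps p \<in> borel_measurable M"
  shows "PQ net SL SE eps \<in> measurable M (PQ_space net)"
  unfolding PQ_def[abs_def]
proof (rule measurable_restrict)
  fix p assume p: "p \<in> random_pairs net"
  note [measurable] = assms(1)[OF p] assms(3)[OF p]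
  have [measurable]: "(\<lambda>w. \<Sum>r=1..renewables net p. Re (SE p r w)) \<in> borel_measurable M"
    "(\<lambda>w. \<Sum>r=1..renewables net p. Im (SE p r w)) \<in> borel_measurable M"
    using assms(2)[OF p]
    by (auto intro!: borel_measurable_sum measurable_compose[OF _ borel_measurable_Re]
        measurable_compose[OF _ borel_measurable_Im])
  show "(\<lambda>w. ((\<Sum>r=1..renewables net p. Re (SE p r w)) - Re (SL p w) + varphi net (fst p) \<bullet> eps p w,
      (\<Sum>r=1..renewables net p. Im (SE p r w)) - Im (SL p w) + varphi_bar net (fst p) \<bullet> eps p w))
      \<in> borel_measurable M"
    by (intro borel_measurable_Pair borel_measurable_add borel_measurable_diff
        borel_measurable_inner borel_measurable_const
        measurable_compose[OF _ borel_measurable_Re] measurable_compose[OF _ borel_measurable_Im])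
      measurable
qed

lemma scenario_program_feeder:
  fixes net :: "'n::finite feeder"
  assumes "prob_space D" and D: "sets D = sets (PQ_space net)"
    and cost: "convex_on (decision_space net) (cost net)" "weight net > 0"
    and ts: "\<forall>t\<in>set ts. convex_on (decision_space net) t"
  shows "scenario_program D (common_feasible net) (UNIV \<times> random_pairs net)
    (power_deficit net) random_power (objective net # ts)"
proof -
  interpret prob_space D by fact
  have fs: "convex_on (decision_space net) t" if "t \<in> set (objective net # ts)" for t
    using that ts convex_on_objective[OF cost] by auto
  show ?thesis
  proof unfold_locales
    show "convex_on (common_feasible net) (power_deficit net j)" for j
      using convex_common_feasible linear_power_deficit[of net j]
      by (intro convex_onI) (simp_all add: linear_add linear_scale)
    show "continuous_on (common_feasible net) (power_deficit net j)" for j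
      using linear_power_deficit[of net j] by (intro linear_continuous_on) (simp add: linear_linear)
    show "random_power j \<in> borel_measurable D" if "j \<in> UNIV \<times> random_pairs net" for j
      using random_power_measurable[OF that] measurable_cong_sets[OF D refl] by blast
    show "convex_on (common_feasible net) t" if "t \<in> set (objective net # ts)" for t
      using convex_on_subset[OF fs[OF that] common_feasible_subset convex_common_feasible] .
    show "continuous_on (common_feasible net) t" if "t \<in> set (objective net # ts)" for t
      using continuous_on_subset[OF convex_on_subspace_continuous[OF subspace_decision_space
            fs[OF that]] common_feasible_subset] .
  qed (simp_all add: compact_common_feasible convex_common_feasible)
qed

lemma MR3_feasible_iff:
  assumes "K \<ge> 1"
  shows "x \<in> MR3_feasible net K z \<longleftrightarrow> x \<in> common_feasible net \<and>
    (\<forall>k\<in>{1..K}. \<forall>j\<in>UNIV \<times> random_pairs net. power_deficit net j x \<le> random_power j (z k))"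
proof -
  have min_iff: "a \<le> b + (MIN k\<in>{1..K}. f k) \<longleftrightarrow> (\<forall>k\<in>{1..K}. a - b \<le> f k)" for a b :: real and f
  proof -
    have "a \<le> b + (MIN k\<in>{1..K}. f k) \<longleftrightarrow> a - b \<le> (MIN k\<in>{1..K}. f k)"
      by linarith
    also have "\<dots> \<longleftrightarrow> (\<forall>k\<in>{1..K}. a - b \<le> f k)"
      using assms by (subst Min_ge_iff) auto
    finally show ?thesis .
  qed
  show ?thesis
    unfolding power_constraints_iff MR3_feasible_def min_iff by (cases x) auto
qed

lemma MR2_feasible_iff:
  fixes net :: "'n::finite feeder"
  assumes "Z \<in> measurable M (PQ_space net)"
  shows "x \<in> MR2_feasible net M Z \<rho> \<longleftrightarrow> x \<in> common_feasible net \<and>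
    1 - \<rho> \<le> measure (distr M (PQ_space net) Z)
      {z \<in> space (PQ_space net). \<forall>j\<in>UNIV \<times> random_pairs net. power_deficit net j x \<le> random_power j z}"
proof -
  let ?S = "{z \<in> space (PQ_space net).
      \<forall>j\<in>UNIV \<times> random_pairs net. power_deficit net j x \<le> random_power j z}"
  have "?S \<in> sets (PQ_space net)"
  proof (rule sets.sets_Collect_finite_All)
    fix j :: "bool \<times> phase \<times> 'n"
    assume "j \<in> UNIV \<times> random_pairs net"
    note [measurable] = random_power_measurable[OF this]
    show "{z \<in> space (PQ_space net). power_deficit net j x \<le> random_power j z} \<in> sets (PQ_space net)"
      by measurable
  qed simp
  then have "measure (distr M (PQ_space net) Z) ?S = measure M (Z -` ?S \<inter> space M)"
    by (rule measure_distr[OF assms])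
  also have "Z -` ?S \<inter> space M = {w \<in> space M. \<forall>(\<phi>, n)\<in>random_pairs net.
      varphi net \<phi> \<bullet> (A_mat net \<phi> n *v fst x) - Re (snd x $ (\<phi>, n)) \<le> fst (Z w (\<phi>, n)) \<and>
      varphi_bar net \<phi> \<bullet> (A_mat net \<phi> n *v fst x) - Im (snd x $ (\<phi>, n)) \<le> snd (Z w (\<phi>, n))}"
    using measurable_space[OF assms] unfolding power_constraints_iff by auto
  finally show ?thesis
    by (cases x) (simp add: MR2_feasible_def)
qed

theorem proposition1:
  fixes net :: "'n::finite feeder"
    and ts :: "('n decision \<Rightarrow> real) list"
    and M :: "'w measure"
    and SL :: "phase \<times> 'n \<Rightarrow> 'w \<Rightarrow> complex"
    and SE :: "phase \<times> 'n \<Rightarrow> nat \<Rightarrow> 'w \<Rightarrow> complex"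
    and eps :: "phase \<times> 'n \<Rightarrow> 'w \<Rightarrow> real ^ 2"
    and M' :: "'v measure"
    and Z :: "nat \<Rightarrow> 'v \<Rightarrow> phase \<times> 'n \<Rightarrow> real \<times> real"
    and K :: nat
    and \<rho> \<beta> :: real
  assumes "feeder net"
    and "weight net > 0"
    and "convex_on (decision_space net) (cost net)"
    and "\<forall>t\<in>set ts. convex_on (decision_space net) t"
    and "prob_space M"
    and "\<And>p. p \<in> random_pairs net \<Longrightarrow> SL p \<in> borel_measurable M"
    and "\<And>p r. p \<in> random_pairs net \<Longrightarrow> r \<in> {1..renewables net p} \<Longrightarrow> SE p r \<in> borel_measurable M"
    and "\<And>p. p \<in> random_pairs net \<Longrightarrow> eps p \<in> borel_measurable M"
    and "prob_space M'"
    and "prob_space.indep_vars M' (\<lambda>_. PQ_space net) Z {1..K}"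
    and "\<And>k. k \<in> {1..K} \<Longrightarrow>
           distr M' (PQ_space net) (Z k) = distr M (PQ_space net) (PQ net SL SE eps)"
    and "0 < \<rho>" "\<rho> < 1" "0 < \<beta>" "\<beta> < 1"
    and "int K \<ge> \<lceil>2 / \<rho> * ln (1 / \<beta>)
           + 4 * (real (card (dg net)) + (\<Sum>l\<in>lines net. real (card (line_phases net l))))
           + 4 * (real (card (dg net)) + (\<Sum>l\<in>lines net. real (card (line_phases net l))))
               / \<rho> * ln (2 / \<rho>)\<rceil>"
  shows "measure M' {v \<in> space M'. \<forall>x. the_MR3_solution net ts K (\<lambda>k. Z k v) x \<longrightarrow>
           x \<in> MR2_feasible net M (PQ net SL SE eps) \<rho>} \<ge> 1 - \<beta>"
proof -
  interpret M: prob_space M by fact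
  interpret M': prob_space M' by fact
  let ?PQ = "PQ net SL SE eps"
  define D where "D = distr M (PQ_space net) ?PQ"
  define d where "d = 2 * (card (dg net) + (\<Sum>l\<in>lines net. card (line_phases net l)))"
  have PQ: "?PQ \<in> measurable M (PQ_space net)"
    by (rule PQ_measurable) (fact assms)+
  have D_sets: "sets D = sets (PQ_space net)"
    by (simp add: D_def)
  have "prob_space D"
    unfolding D_def by (rule M.prob_space_distr[OF PQ])
  then interpret D: scenario_program D "common_feasible net" "UNIV \<times> random_pairs net"
    "power_deficit net" random_power "objective net # ts"
    using D_sets assms(2-4) by (intro scenario_program_feeder) auto

  have "2 / \<rho> * ln (1 / \<beta>) + 2 * d + 2 * d / \<rho> * ln (2 / \<rho>) \<le> K"
    using assms(16) by (simp add: d_def ceiling_le_iff)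
  note K = sample_size_suffices[OF assms(12-15) this]
  have "0 < 2 / \<rho> * ln (1 / \<beta>)"
    using assms(12-15) by (intro mult_pos_pos) auto
  moreover have "0 \<le> 2 * d / \<rho> * ln (2 / \<rho>)"
    using assms(12-15) by (intro mult_nonneg_nonneg) auto
  ultimately have "0 < real K"
    using \<open>2 / \<rho> * ln (1 / \<beta>) + 2 * d + 2 * d / \<rho> * ln (2 / \<rho>) \<le> K\<close> by linarith
  then have K1: "K \<ge> 1" by simp
  then have ne: "{1..K} \<noteq> {}" by simp

  have dim: "dim (common_feasible net) \<le> d"
    unfolding d_def using dim_subset[OF common_feasible_subset] dim_decision_space_le
    by (rule order_trans)

  \<comment> \<open>Independence turns the joint law of the samples into a product measure.\<close>
  define Zs where "Zs v = (\<lambda>k\<in>{1..K}. Z k v)" for v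
  have rv: "Z k \<in> measurable M' (PQ_space net)" if "k \<in> {1..K}" for k
    using assms(10) that unfolding M'.indep_vars_def by auto
  have Zs: "Zs \<in> measurable M' (PiM {1..K} (\<lambda>_. D))"
    unfolding Zs_def using rv by (intro measurable_restrict) (simp add: measurable_cong_sets[OF refl D_sets])
  have "distr M' (PiM {1..K} (\<lambda>_. PQ_space net)) Zs =
      PiM {1..K} (\<lambda>k. distr M' (PQ_space net) (Z k))"
    using M'.indep_vars_iff_distr_eq_PiM'[OF ne, where M' = "\<lambda>_. PQ_space net" and X = Z] rv assms(10)
    unfolding Zs_def by simp
  also have "\<dots> = PiM {1..K} (\<lambda>_. D)"
    using assms(11) by (intro PiM_cong) (auto simp: D_def)
  also have "distr M' (PiM {1..K} (\<lambda>_. PQ_space net)) Zs = distr M' (PiM {1..K} (\<lambda>_. D)) Zs"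
    by (intro distr_cong sets_PiM_cong D_sets[symmetric] refl)
  finally have distr: "distr M' (PiM {1..K} (\<lambda>_. D)) Zs = PiM {1..K} (\<lambda>_. D)" .

  have sol: "the_MR3_solution net ts K (\<lambda>k. Z k v) x \<longleftrightarrow>
      break_ties (objective net # ts) (D.feasible {1..K} (Zs v)) = {x}" for v x
  proof -
    have "MR3_feasible net K (\<lambda>k. Z k v) = D.feasible {1..K} (Zs v)"
      by (rule set_eqI)
        (simp add: MR3_feasible_iff[OF K1] D.feasible_def Zs_def del: One_nat_def)
    then show ?thesis
      by (simp add: the_MR3_solution_def MR3_optimal_def)
  qed
  have mr2: "x \<in> MR2_feasible net M ?PQ \<rho> \<longleftrightarrow> 1 - \<rho> \<le> D.prob (D.satisfied x)"
    if "x \<in> common_feasible net" for x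
    unfolding MR2_feasible_iff[OF PQ] D.satisfied_def D_def[symmetric] sets_eq_imp_space_eq[OF D_sets]
    using that by simp
  define bad where "bad = Zs -` D.bad_samples {1..K} (1 - \<rho>) \<inter> space M'"
  have bad_sets: "bad \<in> sets M'"
    unfolding bad_def using D.bad_samples_sets Zs by (intro measurable_sets) auto
  have "{v \<in> space M'. \<forall>x. the_MR3_solution net ts K (\<lambda>k. Z k v) x \<longrightarrow>
      x \<in> MR2_feasible net M ?PQ \<rho>} = space M' - bad"
  proof -
    have "(\<forall>x. the_MR3_solution net ts K (\<lambda>k. Z k v) x \<longrightarrow> x \<in> MR2_feasible net M ?PQ \<rho>) \<longleftrightarrow> v \<notin> bad"
      if v: "v \<in> space M'" for v
    proof -
      have "x \<in> common_feasible net"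
        if "break_ties (objective net # ts) (D.feasible {1..K} (Zs v)) = {x}" for x
        using break_ties_subset[of "objective net # ts" "D.feasible {1..K} (Zs v)"]
          D.feasible_subset[of "{1..K}" "Zs v"]
        unfolding that by blast
      then have "(\<forall>x. the_MR3_solution net ts K (\<lambda>k. Z k v) x \<longrightarrow> x \<in> MR2_feasible net M ?PQ \<rho>) \<longleftrightarrow>
          \<not> (\<exists>x. break_ties (objective net # ts) (D.feasible {1..K} (Zs v)) = {x} \<and>
            D.prob (D.satisfied x) < 1 - \<rho>)"
        unfolding sol using mr2 by (metis not_le)
      also have "\<dots> \<longleftrightarrow> v \<notin> bad"
        using v measurable_space[OF Zs v]
        by (simp add: bad_def D.bad_samples_def del: break_ties.simps)
      finally show ?thesis .
    qed
    then show ?thesis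
      by (intro set_eqI) (simp only: mem_Collect_eq Diff_iff, blast)
  qed
  moreover have "M'.prob bad \<le> \<beta>"
  proof -
    have "M'.prob bad = measure (PiM {1..K} (\<lambda>_. D)) (D.bad_samples {1..K} (1 - \<rho>))"
      using measure_distr[OF Zs D.bad_samples_sets[OF finite_atLeastAtMost]]
      unfolding distr bad_def by (rule sym)
    also have "\<dots> \<le> (card {1..K} choose d) * (1 - \<rho>) ^ (card {1..K} - d)"
      using dim K(1) assms(13) by (intro D.scenario_bound) auto
    also have "\<dots> \<le> \<beta>"
      using K(2) by simp
    finally show ?thesis .
  qed
  ultimately show ?thesis
    using M'.prob_compl[OF bad_sets] by simp
qed

end
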